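(* The finite satisfiability problem for $\mathcal{FL}^2 3\mathrm{T}$, the two-variable fluted fragment (without equality) with three distinguished transitive relations, is undecidable.
   Context: Signatures are purely relational, predicates of fixed arity (nullary allowed). Fix variables $x_1,x_2,\ldots$. For $m\ge0$, $\mathcal{FL}^{[m]}$ is defined inductively: atoms $p(x_\ell,\ldots,x_m)$ with $p$ a non-equality predicate and $x_\ell,\ldots,x_m$ a contiguous (possibly empty) final segment of $x_1,\ldots,x_m$ belong to it; it is closed under Boolean combinations; if $\phi\in\mathcal{FL}^{[m+1]}$ then $\exists x_{m+1}\phi,\forall x_{m+1}\phi\in\mathcal{FL}^{[m]}$. Equality is not available. $\mathcal{FL}^2 3\mathrm{T}$ consists of fluted sentences using at most two distinct variables over signatures containing three distinguished binary predicates that must be interpreted as transitive relations. The finite satisfiability problem asks whether a given sentence has a finite model in which the distinguished predicates are transitive. *)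

theory Defs
  imports Main "HOL-Library.Nat_Bijection"
begin

section \<open>Relational first-order logic without equality\<close>

text \<open>One universal signature is used: the three distinguished binary predicates together
  with countably many further predicates of every arity (\<open>Pred k n\<close> is the \<open>n\<close>-th predicate
  of arity \<open>k\<close>). The symbols occurring in a formula form its finite signature.\<close>

datatype psym = T1 | T2 | T3 | Pred nat nat

fun arity :: "psym \<Rightarrow> nat" where
  "arity (Pred k n) = k"
| "arity T1 = 2"
| "arity T2 = 2"
| "arity T3 = 2"

text \<open>The number \<open>i\<close> stands for the variable \<open>x\<^sub>i\<close>.\<close>

datatype fm =
    Atom psym "nat list"
  | Neg fm
  | Conj fm fm
  | Disj fm fm
  | Impl fm fm
  | Equiv fm fm
  | Exists nat fm
  | Forall nat fm

text \<open>All variables, including those that occur only directly after a quantifier.\<close>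

fun vars :: "fm \<Rightarrow> nat set" where
  "vars (Atom p xs) = set xs"
| "vars (Neg \<phi>) = vars \<phi>"
| "vars (Conj \<phi> \<psi>) = vars \<phi> \<union> vars \<psi>"
| "vars (Disj \<phi> \<psi>) = vars \<phi> \<union> vars \<psi>"
| "vars (Impl \<phi> \<psi>) = vars \<phi> \<union> vars \<psi>"
| "vars (Equiv \<phi> \<psi>) = vars \<phi> \<union> vars \<psi>"
| "vars (Exists x \<phi>) = insert x (vars \<phi>)"
| "vars (Forall x \<phi>) = insert x (vars \<phi>)"

record 'a struct =
  universe :: "'a set"
  interp :: "psym \<Rightarrow> 'a list \<Rightarrow> bool"

fun sat :: "'a struct \<Rightarrow> (nat \<Rightarrow> 'a) \<Rightarrow> fm \<Rightarrow> bool" where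
  "sat M v (Atom p xs) \<longleftrightarrow> interp M p (map v xs)"
| "sat M v (Neg \<phi>) \<longleftrightarrow> \<not> sat M v \<phi>"
| "sat M v (Conj \<phi> \<psi>) \<longleftrightarrow> sat M v \<phi> \<and> sat M v \<psi>"
| "sat M v (Disj \<phi> \<psi>) \<longleftrightarrow> sat M v \<phi> \<or> sat M v \<psi>"
| "sat M v (Impl \<phi> \<psi>) \<longleftrightarrow> (sat M v \<phi> \<longrightarrow> sat M v \<psi>)"
| "sat M v (Equiv \<phi> \<psi>) \<longleftrightarrow> (sat M v \<phi> \<longleftrightarrow> sat M v \<psi>)"
| "sat M v (Exists x \<phi>) \<longleftrightarrow> (\<exists>a\<in>universe M. sat M (v(x := a)) \<phi>)"
| "sat M v (Forall x \<phi>) \<longleftrightarrow> (\<forall>a\<in>universe M. sat M (v(x := a)) \<phi>)"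

definition models :: "'a struct \<Rightarrow> fm \<Rightarrow> bool" where
  "models M \<phi> \<longleftrightarrow> (\<forall>v. range v \<subseteq> universe M \<longrightarrow> sat M v \<phi>)"

definition transitive_in :: "'a struct \<Rightarrow> psym \<Rightarrow> bool" where
  "transitive_in M p \<longleftrightarrow> transp_on (universe M) (\<lambda>a b. interp M p [a, b])"

definition finite_model_3T :: "'a struct \<Rightarrow> fm \<Rightarrow> bool" where
  "finite_model_3T M \<phi> \<longleftrightarrow>
     finite (universe M) \<and> universe M \<noteq> {} \<and>
     transitive_in M T1 \<and> transitive_in M T2 \<and> transitive_in M T3 \<and>
     models M \<phi>"

text \<open>Finite universes may be taken to consist of natural numbers;
  see \<open>finite_model_3T_imp_fin_sat\<close> below.\<close>

definition fin_sat :: "fm \<Rightarrow> bool" where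
  "fin_sat \<phi> \<longleftrightarrow> (\<exists>M :: nat struct. finite_model_3T M \<phi>)"

lemma sat_transfer:
  assumes inj: "inj_on h (universe M)"
    and N: "universe N = h ` universe M"
    and I: "\<And>p as. set as \<subseteq> universe M \<Longrightarrow> interp N p (map h as) = interp M p as"
  shows "range v \<subseteq> universe M \<Longrightarrow> sat N (h \<circ> v) \<phi> = sat M v \<phi>"
proof (induction \<phi> arbitrary: v)
  case (Atom p xs)
  then have "set (map v xs) \<subseteq> universe M" by auto
  from I[OF this, of p] show ?case by (simp add: comp_def)
next
  case (Exists x \<phi>)
  have upd: "sat N ((h \<circ> v)(x := h a)) \<phi> = sat M (v(x := a)) \<phi>" if "a \<in> universe M" for a
  proof -
    have "range (v(x := a)) \<subseteq> universe M" using Exists.prems that by auto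
    have "h \<circ> v(x := a) = (h \<circ> v)(x := h a)" by auto
    with Exists.IH[OF \<open>range (v(x := a)) \<subseteq> universe M\<close>] show ?thesis by metis
  qed
  then show ?case by (simp add: N comp_def)
next
  case (Forall x \<phi>)
  have upd: "sat N ((h \<circ> v)(x := h a)) \<phi> = sat M (v(x := a)) \<phi>" if "a \<in> universe M" for a
  proof -
    have "range (v(x := a)) \<subseteq> universe M" using Forall.prems that by auto
    have "h \<circ> v(x := a) = (h \<circ> v)(x := h a)" by auto
    with Forall.IH[OF \<open>range (v(x := a)) \<subseteq> universe M\<close>] show ?thesis by metis
  qed
  then show ?case by (simp add: N comp_def)
qed auto

lemma finite_model_3T_imp_fin_sat:
  fixes M :: "'a struct"
  assumes "finite_model_3T M \<phi>"
  shows "fin_sat \<phi>"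
proof -
  let ?U = "universe M"
  have fin: "finite ?U" and ne: "?U \<noteq> {}" and mod: "models M \<phi>"
    and tr: "transitive_in M T1" "transitive_in M T2" "transitive_in M T3"
    using assms by (auto simp: finite_model_3T_def)
  obtain h :: "'a \<Rightarrow> nat" where inj: "inj_on h ?U"
    using finite_imp_inj_to_nat_seg[OF fin] by auto
  define g where "g = inv_into ?U h"
  have gh: "g (h a) = a" if "a \<in> ?U" for a
    using that inj by (simp add: g_def)
  define N :: "nat struct"
    where "N = \<lparr>universe = h ` ?U, interp = (\<lambda>p as. interp M p (map g as))\<rparr>"
  have U: "universe N = h ` ?U" by (simp add: N_def)
  have I: "interp N p (map h as) = interp M p as" if "set as \<subseteq> ?U" for p as
  proof -
    have "map g (map h as) = as" using that gh by (induction as) auto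
    then show ?thesis by (simp add: N_def)
  qed
  have "transitive_in N p" if "transitive_in M p" for p
  proof -
    have "interp N p [h a, h b] = interp M p [a, b]" if "a \<in> ?U" "b \<in> ?U" for a b
      using I[of "[a, b]" p] that by simp
    then show ?thesis
      using that unfolding transitive_in_def transp_on_def U by blast
  qed
  moreover have "models N \<phi>"
    unfolding models_def
  proof (intro allI impI)
    fix w :: "nat \<Rightarrow> nat" assume w: "range w \<subseteq> universe N"
    have gr: "range (g \<circ> w) \<subseteq> ?U" using w gh unfolding U by fastforce
    have "h \<circ> (g \<circ> w) = w"
    proof
      fix i
      have "w i \<in> h ` ?U" using w by (auto simp: U)
      then show "(h \<circ> (g \<circ> w)) i = w i" using gh by auto
    qed
    moreover have "sat N (h \<circ> (g \<circ> w)) \<phi> = sat M (g \<circ> w) \<phi>"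
      by (rule sat_transfer[OF inj U _ gr]) (rule I)
    ultimately show "sat N w \<phi>"
      using mod gr by (simp add: models_def)
  qed
  ultimately have "finite_model_3T N \<phi>"
    using fin ne tr by (simp add: finite_model_3T_def U)
  then show ?thesis by (auto simp: fin_sat_def)
qed


section \<open>The fluted fragment\<close>

text \<open>The argument list of an atom at level \<open>m\<close> is \<open>x\<^sub>l, \<dots>, x\<^sub>m\<close>, which is empty
  for \<open>l = m + 1\<close>.\<close>

inductive fluted :: "nat \<Rightarrow> fm \<Rightarrow> bool" where
  atom: "\<lbrakk>1 \<le> l; l \<le> m + 1; arity p = length [l..<m + 1]\<rbrakk> \<Longrightarrow> fluted m (Atom p [l..<m + 1])"
| neg: "fluted m \<phi> \<Longrightarrow> fluted m (Neg \<phi>)"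
| conj: "\<lbrakk>fluted m \<phi>; fluted m \<psi>\<rbrakk> \<Longrightarrow> fluted m (Conj \<phi> \<psi>)"
| disj: "\<lbrakk>fluted m \<phi>; fluted m \<psi>\<rbrakk> \<Longrightarrow> fluted m (Disj \<phi> \<psi>)"
| impl: "\<lbrakk>fluted m \<phi>; fluted m \<psi>\<rbrakk> \<Longrightarrow> fluted m (Impl \<phi> \<psi>)"
| equiv: "\<lbrakk>fluted m \<phi>; fluted m \<psi>\<rbrakk> \<Longrightarrow> fluted m (Equiv \<phi> \<psi>)"
| ex: "fluted (m + 1) \<phi> \<Longrightarrow> fluted m (Exists (m + 1) \<phi>)"
| all: "fluted (m + 1) \<phi> \<Longrightarrow> fluted m (Forall (m + 1) \<phi>)"

text \<open>Fluted sentences are the formulas of level \<open>0\<close>.\<close>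

definition FL2_3T :: "fm set" where
  "FL2_3T = {\<phi>. fluted 0 \<phi> \<and> card (vars \<phi>) \<le> 2}"


section \<open>Decidability\<close>

text \<open>Partial recursive functions, given by programs with a big-step semantics;
  \<open>rec_eval f xs y\<close> says that \<open>f\<close> halts on \<open>xs\<close> with result \<open>y\<close>. Arities are implicit:
  a program may be run on argument lists of any length and may be undefined on some lengths.\<close>

datatype recf =
    Zero
  | Succ
  | Proj nat
  | Comp recf "recf list"
  | PrimRec recf recf
  | Mu recf

inductive rec_eval :: "recf \<Rightarrow> nat list \<Rightarrow> nat \<Rightarrow> bool" where
  zero: "rec_eval Zero xs 0"
| succ: "rec_eval Succ [x] (Suc x)"
| proj: "i < length xs \<Longrightarrow> rec_eval (Proj i) xs (xs ! i)"
| comp: "\<lbrakk>list_all2 (\<lambda>g y. rec_eval g xs y) gs ys; rec_eval f ys z\<rbrakk>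
    \<Longrightarrow> rec_eval (Comp f gs) xs z"
| prim_0: "rec_eval f xs z \<Longrightarrow> rec_eval (PrimRec f g) (0 # xs) z"
| prim_Suc: "\<lbrakk>rec_eval (PrimRec f g) (n # xs) y; rec_eval g (n # y # xs) z\<rbrakk>
    \<Longrightarrow> rec_eval (PrimRec f g) (Suc n # xs) z"
| mu: "\<lbrakk>rec_eval f (n # xs) 0; \<forall>m<n. \<exists>y. rec_eval f (m # xs) (Suc y)\<rbrakk>
    \<Longrightarrow> rec_eval (Mu f) xs n"

inductive_cases rec_eval_ZeroE: "rec_eval Zero xs z"
inductive_cases rec_eval_SuccE: "rec_eval Succ xs z"
inductive_cases rec_eval_ProjE: "rec_eval (Proj i) xs z"
inductive_cases rec_eval_CompE: "rec_eval (Comp f gs) xs z"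
inductive_cases rec_eval_prim_0E: "rec_eval (PrimRec f g) (0 # xs) z"
inductive_cases rec_eval_prim_SucE: "rec_eval (PrimRec f g) (Suc n # xs) z"
inductive_cases rec_eval_MuE: "rec_eval (Mu f) xs z"

lemma rec_eval_deterministic: "rec_eval f xs y \<Longrightarrow> rec_eval f xs z \<Longrightarrow> y = z"
proof (induction arbitrary: z rule: rec_eval.induct)
  case (zero xs)
  then show ?case by (rule rec_eval_ZeroE) simp
next
  case (succ x)
  then show ?case by (rule rec_eval_SuccE) simp
next
  case (proj i xs)
  from proj.prems show ?case by (rule rec_eval_ProjE) simp
next
  case (comp xs gs ys f z')
  from comp.prems obtain ys' where
    ys': "list_all2 (\<lambda>g y. rec_eval g xs y) gs ys'" "rec_eval f ys' z"
    by (rule rec_eval_CompE)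
  have "ys = ys'"
  proof (rule nth_equalityI)
    show "length ys = length ys'"
      using comp.IH(1) ys'(1) by (auto dest!: list_all2_lengthD)
    fix i assume "i < length ys"
    then show "ys ! i = ys' ! i"
      using comp.IH(1) ys'(1) by (auto simp: list_all2_conv_all_nth)
  qed
  with ys' comp.IH(2) show ?case by blast
next
  case (prim_0 f xs z' g)
  from prim_0.prems have "rec_eval f xs z" by (rule rec_eval_prim_0E)
  then show ?case by (rule prim_0.IH)
next
  case (prim_Suc f g n xs y z')
  from prim_Suc.prems obtain y' where
    y': "rec_eval (PrimRec f g) (n # xs) y'" "rec_eval g (n # y' # xs) z"
    by (rule rec_eval_prim_SucE)
  from prim_Suc.IH(1)[OF y'(1)] y'(2) have "rec_eval g (n # y # xs) z" by simp
  then show ?case by (rule prim_Suc.IH(2))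
next
  case (mu f n xs)
  from mu.prems have z: "rec_eval f (z # xs) 0" "\<forall>m<z. \<exists>y. rec_eval f (m # xs) (Suc y)"
    by (rule rec_eval_MuE; blast)+
  show ?case
  proof (cases n z rule: linorder_cases)
    case less
    then obtain y where "rec_eval f (n # xs) (Suc y)" using z(2) by blast
    from mu.IH(1)[OF this] show ?thesis by simp
  next
    case greater
    then obtain y where "\<forall>w. rec_eval f (z # xs) w \<longrightarrow> Suc y = w"
      using mu.IH(2) by blast
    with z(1) show ?thesis by blast
  qed
qed

fun psym_code :: "psym \<Rightarrow> nat" where
  "psym_code T1 = 0"
| "psym_code T2 = 1"
| "psym_code T3 = 2"
| "psym_code (Pred k n) = 3 + prod_encode (k, n)"

fun fm_code :: "fm \<Rightarrow> nat" where
  "fm_code (Atom p xs) = prod_encode (0, prod_encode (psym_code p, list_encode xs))"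
| "fm_code (Neg \<phi>) = prod_encode (1, fm_code \<phi>)"
| "fm_code (Conj \<phi> \<psi>) = prod_encode (2, prod_encode (fm_code \<phi>, fm_code \<psi>))"
| "fm_code (Disj \<phi> \<psi>) = prod_encode (3, prod_encode (fm_code \<phi>, fm_code \<psi>))"
| "fm_code (Impl \<phi> \<psi>) = prod_encode (4, prod_encode (fm_code \<phi>, fm_code \<psi>))"
| "fm_code (Equiv \<phi> \<psi>) = prod_encode (5, prod_encode (fm_code \<phi>, fm_code \<psi>))"
| "fm_code (Exists x \<phi>) = prod_encode (6, prod_encode (x, fm_code \<phi>))"
| "fm_code (Forall x \<phi>) = prod_encode (7, prod_encode (x, fm_code \<phi>))"

lemma psym_code_eq_iff: "psym_code p = psym_code q \<longleftrightarrow> p = q"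
  by (cases p; cases q) auto

lemma inj_fm_code: "inj fm_code"
proof (rule injI)
  fix \<phi> \<psi> show "fm_code \<phi> = fm_code \<psi> \<Longrightarrow> \<phi> = \<psi>"
  proof (induction \<phi> arbitrary: \<psi>)
    case (Atom p xs) then show ?case by (cases \<psi>) (auto simp: psym_code_eq_iff list_encode_eq)
  next
    case (Neg a) then show ?case by (cases \<psi>) auto
  next
    case (Conj a b) then show ?case by (cases \<psi>) auto
  next
    case (Disj a b) then show ?case by (cases \<psi>) auto
  next
    case (Impl a b) then show ?case by (cases \<psi>) auto
  next
    case (Equiv a b) then show ?case by (cases \<psi>) auto
  next
    case (Exists x a) then show ?case by (cases \<psi>) auto
  next
    case (Forall x a) then show ?case by (cases \<psi>) auto
  qed
qed

text \<open>The problem with instance set \<open>I\<close> and question \<open>Q\<close> is decidable if some partial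
  recursive function halts with the correct answer on the code of every instance. Nothing is
  required on numbers that do not code an instance.\<close>

definition decidable_problem :: "fm set \<Rightarrow> (fm \<Rightarrow> bool) \<Rightarrow> bool" where
  "decidable_problem I Q \<longleftrightarrow>
     (\<exists>f. \<forall>\<phi>\<in>I. rec_eval f [fm_code \<phi>] (if Q \<phi> then 1 else 0))"

end

theory Submission
  imports Defs "HOL-Library.FuncSet"
begin

text \<open>From a counter machine we write a sentence that has a finite model if and only if the machine
  halts on an input \<open>n\<close>. Its models contain a grid whose row \<open>t\<close> is the configuration at time \<open>t\<close>, with
  registers in unary. The grid is forced as follows. Every point of a row at which
  the machine has not halted has an upward successor, and only the bottom row has successors to the
  right. In row \<open>j\<close>, horizontal edges lead from even to odd columns and belong to the transitive
  relation \<open>j + 1\<close> (modulo 3); upward edges from row \<open>j\<close> belong to \<open>j\<close> in even columns and to \<open>j + 1\<close>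
  in odd ones. For a horizontal edge \<open>x y\<close> with upward edges \<open>x z\<close> and \<open>y w\<close>, transitivity puts \<open>(x, w)\<close>
  into relation \<open>j + 1\<close>. The sentence says that such a pair is then not in relation \<open>j\<close>, so neither is
  \<open>(z, w)\<close>, because \<open>(x, z)\<close> is. The sentence also says that two points of the types of \<open>z\<close> and \<open>w\<close>
  are in relation \<open>j\<close> or joined by a horizontal edge. So the square closes. In the intended model,
  relation \<open>j\<close> holds between all points of these types that are not neighbours, and with this
  choice all compositions of edges stay harmless. Only the edges that leave the odd columns of the
  bottom row point to the right; they are in relation 0, and the squares over them close in the same way
  with \<open>z\<close> and \<open>w\<close> exchanged.

  One register is a clock, so a run that does not halt never repeats a configuration, whereas in a
  finite model two rows of the grid coincide.

  Undecidability follows by diagonalisation. The sentence for machine and input is a conjunction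
  of one sentence for each of them, so the code of the machine's sentence serves as a code of the
  machine, and no universal machine is needed.\<close>

section \<open>Counter programs\<close>

datatype com =
    CSkip
  | CInc nat
  | CDec nat
  | CSeq com com
  | CWhile nat com

inductive exec :: "com \<Rightarrow> (nat \<Rightarrow> nat) \<Rightarrow> (nat \<Rightarrow> nat) \<Rightarrow> bool" where
  skip: "exec CSkip s s"
| inc: "exec (CInc r) s (s(r := Suc (s r)))"
| dec: "exec (CDec r) s (s(r := s r - 1))"
| seq: "exec c s t \<Longrightarrow> exec d t u \<Longrightarrow> exec (CSeq c d) s u"
| while_0: "s r = 0 \<Longrightarrow> exec (CWhile r c) s s"
| while_Suc: "s r \<noteq> 0 \<Longrightarrow> exec c s t \<Longrightarrow> exec (CWhile r c) t u \<Longrightarrow> exec (CWhile r c) s u"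

definition clear :: "nat \<Rightarrow> com" where
  "clear r = CWhile r (CDec r)"

lemma exec_clear: "exec (clear r) s (s(r := 0))"
proof (induction "s r" arbitrary: s)
  case 0
  have "s(r := 0) = s" using 0 by auto
  moreover have "exec (clear r) s s"
    unfolding clear_def using 0 by (intro while_0) simp
  ultimately show ?case by (simp only:)
next
  case (Suc n)
  from Suc.hyps(1)[of "s(r := s r - 1)"] Suc.hyps(2)
  have "exec (clear r) (s(r := s r - 1)) (s(r := 0))" by simp
  then show ?case
    unfolding clear_def using Suc.hyps(2) dec[of r s] by (metis while_Suc nat.distinct(1))
qed

definition move2 :: "nat \<Rightarrow> nat \<Rightarrow> nat \<Rightarrow> com" where
  "move2 r d e = CWhile r (CSeq (CDec r) (CSeq (CInc d) (CInc e)))"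

lemma exec_move2:
  assumes "r \<noteq> d" "r \<noteq> e" "d \<noteq> e"
  shows "exec (move2 r d e) s (s(r := 0, d := s d + s r, e := s e + s r))"
proof (induction "s r" arbitrary: s)
  case 0
  have "s(r := 0, d := s d + s r, e := s e + s r) = s" using 0 by auto
  moreover have "exec (move2 r d e) s s"
    unfolding move2_def using 0 by (intro while_0) simp
  ultimately show ?case by (simp only:)
next
  case (Suc n)
  let ?s = "s(r := s r - 1, d := Suc (s d), e := Suc (s e))"
  have b: "exec (CSeq (CDec r) (CSeq (CInc d) (CInc e))) s ?s"
    using assms dec[of r s] inc[of d "s(r := s r - 1)"]
      inc[of e "s(r := s r - 1, d := Suc (s d))"]
    by (auto intro!: seq)
  have "?s(r := 0, d := ?s d + ?s r, e := ?s e + ?s r) = s(r := 0, d := s d + s r, e := s e + s r)"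
    using assms Suc.hyps(2)[symmetric] by (auto simp: fun_eq_iff)
  with Suc.hyps(1)[of ?s] Suc.hyps(2)[symmetric] assms
  have "exec (move2 r d e) ?s (s(r := 0, d := s d + s r, e := s e + s r))" by simp
  then show ?case
    unfolding move2_def using b Suc.hyps(2) by (metis while_Suc nat.distinct(1))
qed

definition move :: "nat \<Rightarrow> nat \<Rightarrow> com" where
  "move r d = CWhile r (CSeq (CDec r) (CInc d))"

lemma exec_move:
  assumes "r \<noteq> d"
  shows "exec (move r d) s (s(r := 0, d := s d + s r))"
proof (induction "s r" arbitrary: s)
  case 0
  have "s(r := 0, d := s d + s r) = s" using 0 by auto
  moreover have "exec (move r d) s s"
    unfolding move_def using 0 by (intro while_0) simp
  ultimately show ?case by (simp only:)
next
  case (Suc n)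
  let ?s = "s(r := s r - 1, d := Suc (s d))"
  have b: "exec (CSeq (CDec r) (CInc d)) s ?s"
    using assms dec[of r s] inc[of d "s(r := s r - 1)"] by (auto intro!: seq)
  have "?s(r := 0, d := ?s d + ?s r) = s(r := 0, d := s d + s r)"
    using assms Suc.hyps(2)[symmetric] by (auto simp: fun_eq_iff)
  with Suc.hyps(1)[of ?s] Suc.hyps(2)[symmetric] assms
  have "exec (move r d) ?s (s(r := 0, d := s d + s r))" by simp
  then show ?case
    unfolding move_def using b Suc.hyps(2) by (metis while_Suc nat.distinct(1))
qed

text \<open>A move destroys its source, so the value of \<open>r\<close> is duplicated into
  \<open>d\<close> and a scratch register \<open>e\<close>, and \<open>r\<close> is then restored
  from \<open>e\<close>.\<close>

definition copy :: "nat \<Rightarrow> nat \<Rightarrow> nat \<Rightarrow> com" where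
  "copy r d e = CSeq (clear d) (CSeq (clear e) (CSeq (move2 r d e) (move e r)))"

lemma exec_copy:
  assumes "r \<noteq> d" "r \<noteq> e" "d \<noteq> e"
  shows "exec (copy r d e) s (s(d := s r, e := 0))"
proof -
  have 1: "exec (move2 r d e) (s(d := 0, e := 0)) (s(d := s r, e := s r, r := 0))"
    using exec_move2[OF assms, of "s(d := 0, e := 0)"] assms
    by (simp add: fun_upd_twist)
  have 2: "exec (move e r) (s(d := s r, e := s r, r := 0)) (s(d := s r, e := 0))"
  proof -
    have "(s(d := s r, e := s r, r := 0))(e := 0, r := (s(d := s r, e := s r, r := 0)) r + (s(d := s r, e := s r, r := 0)) e)
      = s(d := s r, e := 0)" using assms by (auto simp: fun_eq_iff)
    then show ?thesis
      using exec_move[of e r "s(d := s r, e := s r, r := 0)"] assms by simp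
  qed
  show ?thesis
    unfolding copy_def by (rule seq[OF exec_clear seq[OF exec_clear seq[OF 1 2]]])
qed

section \<open>Compiling partial recursive functions\<close>

text \<open>Only values that exist are required to be computed; divergence plays no role.\<close>

definition computes :: "recf \<Rightarrow> nat list \<Rightarrow> nat \<Rightarrow> nat \<Rightarrow> com \<Rightarrow> bool" where
  "computes g xs y b c \<longleftrightarrow>
     (\<forall>s z. rec_eval g (map s xs) z \<longrightarrow>
        (\<exists>t. exec c s t \<and> t y = z \<and> (\<forall>r<b. r \<noteq> y \<longrightarrow> t r = s r)))"

text \<open>Registers from \<open>b\<close> on are scratch space. Quantifying over all
  \<open>b\<close> lets a caller protect its own intermediate results by raising \<open>b\<close>;
  the code may depend on the registers chosen.\<close>

definition computable :: "recf \<Rightarrow> bool" where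
  "computable g \<longleftrightarrow>
     (\<forall>xs y b. (\<forall>r\<in>set xs. r < b) \<and> y < b \<and> y \<notin> set xs \<longrightarrow> (\<exists>c. computes g xs y b c))"

lemma computableD:
  assumes "computable g" "\<And>r. r \<in> set xs \<Longrightarrow> r < b" "y < b" "y \<notin> set xs"
  obtains c where "computes g xs y b c"
  using assms unfolding computable_def by blast

lemma computesD:
  assumes "computes g xs y b c" "rec_eval g (map s xs) z"
  obtains t where "exec c s t" "t y = z" "\<And>r. r < b \<Longrightarrow> r \<noteq> y \<Longrightarrow> t r = s r"
  using assms unfolding computes_def by blast

lemma computable_Zero: "computable Zero"
  unfolding computable_def computes_def
proof (intro allI impI)
  fix xs :: "nat list" and y b :: nat
  show "\<exists>c. \<forall>s z. rec_eval Zero (map s xs) z \<longrightarrow>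
     (\<exists>t. exec c s t \<and> t y = z \<and> (\<forall>r<b. r \<noteq> y \<longrightarrow> t r = s r))"
    using exec_clear[of y] by (intro exI[of _ "clear y"]) (fastforce elim: rec_eval_ZeroE)
qed

lemma computable_Succ: "computable Succ"
  unfolding computable_def
proof (intro allI impI)
  fix xs :: "nat list" and y b :: nat
  assume A: "(\<forall>r\<in>set xs. r < b) \<and> y < b \<and> y \<notin> set xs"
  have "computes Succ xs y b (CSeq (copy (hd xs) y b) (CInc y))"
    unfolding computes_def
  proof (intro allI impI)
    fix s z
    assume "rec_eval Succ (map s xs) z"
    then obtain x where x: "xs = [x]" "z = Suc (s x)" by (auto elim!: rec_eval_SuccE)
    then have "exec (copy (hd xs) y b) s (s(y := s x, b := 0))"
      using A exec_copy[of x y b s] by auto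
    then have "exec (CSeq (copy (hd xs) y b) (CInc y)) s (s(y := s x, b := 0, y := Suc (s x)))"
      using seq[OF _ inc[of y "s(y := s x, b := 0)"]] A by simp
    then show "\<exists>t. exec (CSeq (copy (hd xs) y b) (CInc y)) s t \<and> t y = z \<and>
        (\<forall>r<b. r \<noteq> y \<longrightarrow> t r = s r)"
      using A x by (intro exI[of _ "s(y := s x, b := 0, y := Suc (s x))"]) simp
  qed
  then show "\<exists>c. computes Succ xs y b c" ..
qed

lemma computable_Proj: "computable (Proj i)"
  unfolding computable_def
proof (intro allI impI)
  fix xs :: "nat list" and y b :: nat
  assume A: "(\<forall>r\<in>set xs. r < b) \<and> y < b \<and> y \<notin> set xs"
  have "computes (Proj i) xs y b (copy (xs ! i) y b)"
    unfolding computes_def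
  proof (intro allI impI)
    fix s z
    assume "rec_eval (Proj i) (map s xs) z"
    then have x: "i < length xs" "z = s (xs ! i)" by (auto elim!: rec_eval_ProjE)
    then have "exec (copy (xs ! i) y b) s (s(y := s (xs ! i), b := 0))"
      using A exec_copy[of "xs ! i" y b s] nth_mem[of i xs] by fastforce
    then show "\<exists>t. exec (copy (xs ! i) y b) s t \<and> t y = z \<and> (\<forall>r<b. r \<noteq> y \<longrightarrow> t r = s r)"
      using A x by (intro exI[of _ "s(y := s (xs ! i), b := 0)"]) simp
  qed
  then show "\<exists>c. computes (Proj i) xs y b c" ..
qed

text \<open>The programs run one after another. For each of them the bound is raised just past its
  own output register, so the later ones preserve both the arguments and the results obtained so
  far.\<close>

lemma computes_list:
  assumes "\<And>g. g \<in> set gs \<Longrightarrow> computable g" "\<And>r. r \<in> set xs \<Longrightarrow> r < d"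
  shows "\<exists>c. \<forall>s ys. list_all2 (\<lambda>g y. rec_eval g (map s xs) y) gs ys \<longrightarrow>
    (\<exists>t. exec c s t \<and> map t [d..<d + length gs] = ys \<and> (\<forall>r<d. t r = s r))"
  using assms
proof (induction gs arbitrary: d)
  case Nil
  then show ?case using skip by (intro exI[of _ CSkip]) auto
next
  case (Cons g gs)
  have d: "r < Suc d" if "r \<in> set xs" for r using Cons.prems(2)[OF that] by simp
  have "d \<notin> set xs" using Cons.prems(2) by blast
  then obtain c1 where c1: "computes g xs d (Suc d) c1"
    using computableD[of g xs "Suc d" d] Cons.prems(1) d by auto
  obtain c2 where c2: "\<And>s ys. list_all2 (\<lambda>g y. rec_eval g (map s xs) y) gs ys \<Longrightarrow>
    \<exists>t. exec c2 s t \<and> map t [Suc d..<Suc d + length gs] = ys \<and> (\<forall>r<Suc d. t r = s r)"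
    using Cons.IH[of "Suc d"] Cons.prems(1) d by auto
  show ?case
  proof (intro exI[of _ "CSeq c1 c2"] allI impI)
    fix s ys'
    assume "list_all2 (\<lambda>g y. rec_eval g (map s xs) y) (g # gs) ys'"
    then obtain y ys where ys: "ys' = y # ys" "rec_eval g (map s xs) y"
      "list_all2 (\<lambda>g y. rec_eval g (map s xs) y) gs ys" by (auto simp: list_all2_Cons1)
    from computesD[OF c1 ys(2)] obtain t where
      t: "exec c1 s t" "t d = y" "\<And>r. r < Suc d \<Longrightarrow> r \<noteq> d \<Longrightarrow> t r = s r" by metis
    have "map t xs = map s xs" using t(3) Cons.prems(2) by (auto simp: less_Suc_eq)
    with c2[of t ys] ys(3) obtain u where
      u: "exec c2 t u" "map u [Suc d..<Suc d + length gs] = ys" "\<forall>r<Suc d. u r = t r" by auto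
    have "[d..<d + length (g # gs)] = d # [Suc d..<Suc d + length gs]"
      by (simp add: upt_conv_Cons del: upt_Suc)
    then have "map u [d..<d + length (g # gs)] = ys'"
      using u(2,3) t(2) ys(1) by (simp del: upt_Suc)
    then show "\<exists>t. exec (CSeq c1 c2) s t \<and> map t [d..<d + length (g # gs)] = ys' \<and>
        (\<forall>r<d. t r = s r)"
      using seq[OF t(1) u(1)] u(3) t(3) by (intro exI[of _ u]) auto
  qed
qed

lemma computable_Comp:
  assumes "computable f" "\<And>g. g \<in> set gs \<Longrightarrow> computable g"
  shows "computable (Comp f gs)"
  unfolding computable_def
proof (intro allI impI)
  fix xs :: "nat list" and y b :: nat
  assume A: "(\<forall>r\<in>set xs. r < b) \<and> y < b \<and> y \<notin> set xs"
  let ?b = "b + length gs"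
  obtain c1 where c1: "\<And>s ys. list_all2 (\<lambda>g y. rec_eval g (map s xs) y) gs ys \<Longrightarrow>
    \<exists>t. exec c1 s t \<and> map t [b..<?b] = ys \<and> (\<forall>r<b. t r = s r)"
    using computes_list[of gs xs b] assms(2) A by blast
  obtain c2 where c2: "computes f [b..<?b] y ?b c2"
    using computableD[OF assms(1), of "[b..<?b]" ?b y] A by auto
  have "computes (Comp f gs) xs y b (CSeq c1 c2)"
    unfolding computes_def
  proof (intro allI impI)
    fix s z
    assume "rec_eval (Comp f gs) (map s xs) z"
    then obtain ys where ys: "list_all2 (\<lambda>g y. rec_eval g (map s xs) y) gs ys" "rec_eval f ys z"
      by (rule rec_eval_CompE)
    from c1[OF ys(1)] obtain t where
      t: "exec c1 s t" "map t [b..<?b] = ys" "\<forall>r<b. t r = s r" by blast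
    from computesD[OF c2, of t z] t(2) ys(2) obtain u where
      u: "exec c2 t u" "u y = z" "\<And>r. r < ?b \<Longrightarrow> r \<noteq> y \<Longrightarrow> u r = t r" by metis
    show "\<exists>t. exec (CSeq c1 c2) s t \<and> t y = z \<and> (\<forall>r<b. r \<noteq> y \<longrightarrow> t r = s r)"
      using seq[OF t(1) u(1)] u t(3) by (intro exI[of _ u]) auto
  qed
  then show "\<exists>c. computes (Comp f gs) xs y b c" ..
qed

text \<open>A derivation for \<open>Suc n\<close> contains one for \<open>n\<close>. A loop that
  counts upwards therefore meets only defined values.\<close>

lemma PrimRec_le:
  assumes "rec_eval (PrimRec f g) (n # xs) y" "m \<le> n"
  shows "\<exists>z. rec_eval (PrimRec f g) (m # xs) z"
  using assms
proof (induction n arbitrary: y)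
  case (Suc n)
  show ?case
  proof (cases "m = Suc n")
    case False
    then show ?thesis using Suc by (auto elim!: rec_eval_prim_SucE)
  qed (use Suc.prems in blast)
qed auto

lemma computable_PrimRec:
  assumes "computable f" "computable g"
  shows "computable (PrimRec f g)"
  unfolding computable_def
proof (intro allI impI)
  fix xs :: "nat list" and y b :: nat
  assume A: "(\<forall>r\<in>set xs. r < b) \<and> y < b \<and> y \<notin> set xs"
  show "\<exists>c. computes (PrimRec f g) xs y b c"
  proof (cases xs)
    case Nil
    have "\<not> rec_eval (PrimRec f g) [] z" for z
      by (rule notI, erule rec_eval.cases) simp_all
    then show ?thesis using Nil by (auto simp: computes_def)
  next
    case (Cons x xs')
    have B: "\<And>r. r \<in> set xs' \<Longrightarrow> r < b" and x: "x < b" and y: "y < b" "y \<noteq> x" "y \<notin> set xs'"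
      using A Cons by auto
    have B4: "r < b + 4" if "r \<in> set xs'" for r using B[OF that] by simp
    have B': "b + 1 \<notin> set xs'" "b + 3 \<notin> set xs'" using B by fastforce+
    obtain c1 where c1: "computes f xs' (b + 1) (b + 4) c1"
      by (rule computableD[OF assms(1) B4, of xs' "b + 1"]) (use B' in auto)
    obtain c2 where c2: "computes g (b # (b + 1) # xs') (b + 3) (b + 4) c2"
      by (rule computableD[OF assms(2), of "b # (b + 1) # xs'" "b + 4" "b + 3"])
        (use B' B4 in auto)
    \<comment> \<open>Register \<open>b\<close> counts the rounds done, \<open>b + 1\<close> holds
      the value reached, \<open>b + 2\<close> the rounds still to do, \<open>b + 3\<close> receives
      the value of \<open>g\<close>, and \<open>b + 4\<close> is scratch for copying.\<close>
    define body where
      "body = CSeq c2 (CSeq (copy (b + 3) (b + 1) (b + 4)) (CSeq (CInc b) (CDec (b + 2))))"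
    define c where "c = CSeq (clear b) (CSeq (copy x (b + 2) (b + 4)) (CSeq c1
      (CSeq (CWhile (b + 2) body) (copy (b + 1) y (b + 4)))))"
    \<comment> \<open>Induction on the rounds still to do. The last premise is the invariant:
      \<open>b + 1\<close> holds the value at stage \<open>s b\<close>.\<close>
    have loop: "\<exists>t. exec (CWhile (b + 2) body) s t \<and> t (b + 1) = z \<and> (\<forall>r<b. t r = s r)"
      if "rec_eval (PrimRec f g) (n # ws) z" "s (b + 2) = k" "s b + k = n" "map s xs' = ws"
        "rec_eval (PrimRec f g) (s b # ws) (s (b + 1))" for n ws z k s
      using that
    proof (induction k arbitrary: s)
      case 0
      then have "s (b + 1) = z" using rec_eval_deterministic by auto
      then show ?case using 0 while_0[of s "b + 2"] by auto
    next
      case (Suc k)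
      obtain w where w: "rec_eval (PrimRec f g) (Suc (s b) # ws) w"
        using PrimRec_le[OF Suc.prems(1), of "Suc (s b)"] Suc.prems(3) by auto
      then obtain w' where "rec_eval (PrimRec f g) (s b # ws) w'" "rec_eval g (s b # w' # ws) w"
        by (rule rec_eval_prim_SucE)
      with Suc.prems(5) have "rec_eval g (map s (b # (b + 1) # xs')) w"
        using rec_eval_deterministic Suc.prems(4) by fastforce
      from computesD[OF c2 this] obtain t where t: "exec c2 s t" "t (b + 3) = w"
        "\<And>r. r < b + 4 \<Longrightarrow> r \<noteq> b + 3 \<Longrightarrow> t r = s r" by metis
      define u where "u = t(b + 1 := w, b + 4 := 0, b := Suc (s b), b + 2 := k)"
      have "exec (copy (b + 3) (b + 1) (b + 4)) t (t(b + 1 := w, b + 4 := 0))"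
        using exec_copy[of "b + 3" "b + 1" "b + 4" t] t(2) by simp
      moreover have "exec (CInc b) (t(b + 1 := w, b + 4 := 0))
          (t(b + 1 := w, b + 4 := 0, b := Suc (s b)))"
        using inc[of b "t(b + 1 := w, b + 4 := 0)"] t(3) by simp
      moreover have "exec (CDec (b + 2)) (t(b + 1 := w, b + 4 := 0, b := Suc (s b))) u"
        using dec[of "b + 2" "t(b + 1 := w, b + 4 := 0, b := Suc (s b))"] t(3) Suc.prems(2)
        by (simp add: u_def)
      ultimately have body: "exec body s u"
        unfolding body_def by (intro seq[OF t(1)] seq)
      have below: "u r = s r" if "r < b" for r using that t(3) by (simp add: u_def)
      have "map u xs' = ws" using below B Suc.prems(4) by auto
      then have "\<exists>t. exec (CWhile (b + 2) body) u t \<and> t (b + 1) = z \<and> (\<forall>r<b. t r = u r)"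
        using Suc.prems w by (intro Suc.IH) (auto simp: u_def)
      then show ?case
        using while_Suc[of s "b + 2" body u] body below Suc.prems(2) by fastforce
    qed
    have "computes (PrimRec f g) xs y b c"
      unfolding computes_def
    proof (intro allI impI)
      fix s z
      assume "rec_eval (PrimRec f g) (map s xs) z"
      then have z: "rec_eval (PrimRec f g) (s x # map s xs') z" by (simp add: Cons)
      obtain w where "rec_eval (PrimRec f g) (0 # map s xs') w"
        using PrimRec_le[OF z, of 0] by auto
      then have w: "rec_eval f (map s xs') w" by (rule rec_eval_prim_0E)
      define s1 where "s1 = s(b := 0, b + 2 := s x, b + 4 := 0)"
      have e1: "exec (copy x (b + 2) (b + 4)) (s(b := 0)) s1"
        using exec_copy[of x "b + 2" "b + 4" "s(b := 0)"] x by (simp add: s1_def)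
      have "map s1 xs' = map s xs'" using B by (fastforce simp: s1_def)
      with w have "rec_eval f (map s1 xs') w" by (simp only:)
      from computesD[OF c1 this] obtain s2 where s2: "exec c1 s1 s2" "s2 (b + 1) = w"
        "\<And>r. r < b + 4 \<Longrightarrow> r \<noteq> b + 1 \<Longrightarrow> s2 r = s1 r" by metis
      have below: "s2 r = s r" if "r < b" for r using that s2(3) by (simp add: s1_def)
      have m2: "map s2 xs' = map s xs'" using below B by auto
      have 2: "s2 b = 0" "s2 (b + 2) = s x" using s2(3) x by (auto simp: s1_def)
      have "rec_eval (PrimRec f g) (s2 b # map s xs') (s2 (b + 1))"
        using 2 s2(2) w by (simp add: prim_0)
      with loop[OF z, of s2 "s x"] m2 2 obtain s3 where
        s3: "exec (CWhile (b + 2) body) s2 s3" "s3 (b + 1) = z" "\<forall>r<b. s3 r = s2 r" by auto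
      have e4: "exec (copy (b + 1) y (b + 4)) s3 (s3(y := z, b + 4 := 0))"
        using exec_copy[of "b + 1" y "b + 4" s3] y s3(2) by simp
      have "exec c s (s3(y := z, b + 4 := 0))"
        unfolding c_def by (intro seq[OF exec_clear] seq[OF e1] seq[OF s2(1)] seq[OF s3(1)] e4)
      then show "\<exists>t. exec c s t \<and> t y = z \<and> (\<forall>r<b. r \<noteq> y \<longrightarrow> t r = s r)"
        using y below s3(3) by (intro exI[of _ "s3(y := z, b + 4 := 0)"]) simp
    qed
    then show ?thesis ..
  qed
qed

lemma computable_Mu:
  assumes "computable f"
  shows "computable (Mu f)"
  unfolding computable_def
proof (intro allI impI)
  fix xs :: "nat list" and y b :: nat
  assume A: "(\<forall>r\<in>set xs. r < b) \<and> y < b \<and> y \<notin> set xs"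
  have A': "\<And>r. r \<in> set xs \<Longrightarrow> r < b + 2" "b + 1 \<notin> set xs" using A by fastforce+
  obtain c1 where c1: "computes f (b # xs) (b + 1) (b + 2) c1"
    by (rule computableD[OF assms, of "b # xs" "b + 2" "b + 1"]) (use A' in auto)
  define c where "c = CSeq (clear b) (CSeq c1
    (CSeq (CWhile (b + 1) (CSeq (CInc b) c1)) (copy b y (b + 2))))"
  \<comment> \<open>Register \<open>b\<close> is the candidate, \<open>b + 1\<close> the value of
    \<open>f\<close> there, and \<open>k\<close> the distance to the least zero \<open>n\<close>.
    All values on the way exist and are nonzero, so the loop does not stop early.\<close>
  have loop: "\<exists>t. exec (CWhile (b + 1) (CSeq (CInc b) c1)) s t \<and> t b = n \<and> (\<forall>r<b. t r = s r)"
    if "rec_eval f (n # ws) 0" "\<forall>m<n. \<exists>y. rec_eval f (m # ws) (Suc y)" "map s xs = ws"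
      "s b + k = n" "rec_eval f (s b # ws) (s (b + 1))" for n ws s k
    using that
  proof (induction k arbitrary: s)
    case 0
    then have "s (b + 1) = 0" using rec_eval_deterministic by auto
    then show ?case using 0 while_0[of s "b + 1"] by auto
  next
    case (Suc k)
    have "s b < n" using Suc.prems(4) by simp
    with Suc.prems(2) obtain v where v: "rec_eval f (s b # ws) (Suc v)" by blast
    then have nz: "s (b + 1) \<noteq> 0" using Suc.prems(5) rec_eval_deterministic by fastforce
    have "\<exists>w. rec_eval f (Suc (s b) # ws) w"
    proof (cases "Suc (s b) = n")
      case False
      then show ?thesis using Suc.prems(2,4) by (metis \<open>s b < n\<close> Suc_lessI)
    qed (use Suc.prems(1) in auto)
    then obtain w where w: "rec_eval f (Suc (s b) # ws) w" ..
    have "map (s(b := Suc (s b))) (b # xs) = Suc (s b) # ws" using A Suc.prems(3) by auto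
    with w have "rec_eval f (map (s(b := Suc (s b))) (b # xs)) w" by (simp only:)
    from computesD[OF c1 this] obtain t where t: "exec c1 (s(b := Suc (s b))) t" "t (b + 1) = w"
      "\<And>r. r < b + 2 \<Longrightarrow> r \<noteq> b + 1 \<Longrightarrow> t r = (s(b := Suc (s b))) r" by metis
    have tb: "t b = Suc (s b)" and below: "\<And>r. r < b \<Longrightarrow> t r = s r" using t(3) by auto
    have "map t xs = ws" using below A Suc.prems(3) by auto
    then have "\<exists>u. exec (CWhile (b + 1) (CSeq (CInc b) c1)) t u \<and> u b = n \<and> (\<forall>r<b. u r = t r)"
      using Suc.prems w tb t(2) by (intro Suc.IH) auto
    then show ?case
      using while_Suc[of s "b + 1" "CSeq (CInc b) c1" t] nz seq[OF inc t(1)] below by fastforce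
  qed
  have "computes (Mu f) xs y b c"
    unfolding computes_def
  proof (intro allI impI)
    fix s z
    assume "rec_eval (Mu f) (map s xs) z"
    then have z: "rec_eval f (z # map s xs) 0" "\<forall>m<z. \<exists>y. rec_eval f (m # map s xs) (Suc y)"
      by (rule rec_eval_MuE; blast)+
    obtain w where w: "rec_eval f (0 # map s xs) w"
      using z by (cases z) auto
    have "map (s(b := 0)) (b # xs) = 0 # map s xs" using A by auto
    with w have "rec_eval f (map (s(b := 0)) (b # xs)) w" by (simp only:)
    from computesD[OF c1 this] obtain t where t: "exec c1 (s(b := 0)) t" "t (b + 1) = w"
      "\<And>r. r < b + 2 \<Longrightarrow> r \<noteq> b + 1 \<Longrightarrow> t r = (s(b := 0)) r" by metis
    have tb: "t b = 0" and below: "\<And>r. r < b \<Longrightarrow> t r = s r" using t(3) by auto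
    have "map t xs = map s xs" using below A by auto
    with loop[OF z, of t z] tb t(2) w obtain u where
      u: "exec (CWhile (b + 1) (CSeq (CInc b) c1)) t u" "u b = z" "\<forall>r<b. u r = t r" by auto
    have "exec (copy b y (b + 2)) u (u(y := z, b + 2 := 0))"
      using exec_copy[of b y "b + 2" u] u(2) A by simp
    then have "exec c s (u(y := z, b + 2 := 0))"
      unfolding c_def by (intro seq[OF exec_clear] seq[OF t(1)] seq[OF u(1)])
    then show "\<exists>t. exec c s t \<and> t y = z \<and> (\<forall>r<b. r \<noteq> y \<longrightarrow> t r = s r)"
      using A below u(3) by (intro exI[of _ "u(y := z, b + 2 := 0)"]) simp
  qed
  then show "\<exists>c. computes (Mu f) xs y b c" ..
qed

lemma all_computable: "computable g"
  by (induction g)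
    (simp_all add: computable_Zero computable_Succ computable_Proj computable_Comp
      computable_PrimRec computable_Mu)

section \<open>Counter machines\<close>

text \<open>\<open>Jz r p q\<close> jumps to \<open>p\<close> if register \<open>r\<close> is zero and to \<open>q\<close> otherwise. A machine has
  halted when its program counter has left the program.\<close>

datatype instr = Inc nat | Dec nat | Jz nat nat nat

fun step :: "instr \<Rightarrow> nat \<times> (nat \<Rightarrow> nat) \<Rightarrow> nat \<times> (nat \<Rightarrow> nat)" where
  "step (Inc r) (pc, s) = (Suc pc, s(r := Suc (s r)))"
| "step (Dec r) (pc, s) = (Suc pc, s(r := s r - 1))"
| "step (Jz r p q) (pc, s) = (if s r = 0 then p else q, s)"

definition next_conf :: "instr list \<Rightarrow> nat \<times> (nat \<Rightarrow> nat) \<Rightarrow> nat \<times> (nat \<Rightarrow> nat)" where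
  "next_conf P x = (if fst x < length P then step (P ! fst x) x else x)"

definition run :: "instr list \<Rightarrow> nat \<times> (nat \<Rightarrow> nat) \<Rightarrow> nat \<Rightarrow> nat \<times> (nat \<Rightarrow> nat)" where
  "run P x t = (next_conf P ^^ t) x"

definition halts :: "instr list \<Rightarrow> nat \<times> (nat \<Rightarrow> nat) \<Rightarrow> bool" where
  "halts P x \<longleftrightarrow> (\<exists>t. length P \<le> fst (run P x t))"

lemma run_0: "run P x 0 = x"
  and run_Suc: "run P x (Suc t) = next_conf P (run P x t)"
  and run_add: "run P x (t + u) = run P (run P x t) u"
  by (simp_all add: run_def add.commute[of t u] funpow_add)

fun csize :: "com \<Rightarrow> nat" where
  "csize CSkip = 0"
| "csize (CInc r) = 1"
| "csize (CDec r) = 1"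
| "csize (CSeq c d) = csize c + csize d"
| "csize (CWhile r c) = csize c + 2"

text \<open>Jump targets are absolute and \<open>e\<close> is the address of the first instruction.
  \<open>Jz 0 e e\<close> has equal targets and so jumps unconditionally;
  \<open>e + csize c + 2\<close> is the address after the loop.\<close>

fun compile :: "com \<Rightarrow> nat \<Rightarrow> instr list" where
  "compile CSkip e = []"
| "compile (CInc r) e = [Inc r]"
| "compile (CDec r) e = [Dec r]"
| "compile (CSeq c d) e = compile c e @ compile d (e + csize c)"
| "compile (CWhile r c) e =
     Jz r (e + csize c + 2) (Suc e) # compile c (Suc e) @ [Jz 0 e e]"

lemma length_compile: "length (compile c e) = csize c"
  by (induction c arbitrary: e) auto

text \<open>Stated for a block within arbitrary surrounding code, since the induction hypotheses are
  applied to smaller blocks of the same program \<open>P\<close>.\<close>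

lemma exec_compile:
  assumes "exec c s t" "P = us @ compile c (length us) @ vs"
  shows "\<exists>k. run P (length us, s) k = (length us + csize c, t)"
  using assms
proof (induction arbitrary: us vs rule: exec.induct)
  case (skip s)
  then show ?case by (auto intro!: exI[of _ 0] simp: run_0)
next
  case (inc r s)
  then have "run P (length us, s) 1 = (length us + csize (CInc r), s(r := Suc (s r)))"
    by (simp add: run_def next_conf_def)
  then show ?case ..
next
  case (dec r s)
  then have "run P (length us, s) 1 = (length us + csize (CDec r), s(r := s r - 1))"
    by (simp add: run_def next_conf_def)
  then show ?case ..
next
  case (seq c s t d u)
  obtain k where k: "run P (length us, s) k = (length us + csize c, t)"
    using seq.IH(1)[of us "compile d (length us + csize c) @ vs"] seq.prems by auto
  obtain l where "run P (length us + csize c, t) l = (length us + csize c + csize d, u)"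
    using seq.IH(2)[of "us @ compile c (length us)" vs] seq.prems
    by (auto simp: length_compile)
  then show ?case using k by (intro exI[of _ "k + l"]) (simp add: run_add)
next
  case (while_0 s r c)
  then show ?case by (auto intro!: exI[of _ 1] simp: run_def next_conf_def)
next
  case (while_Suc s r c t u)
  let ?e = "length us"
  have P: "P = (us @ [Jz r (?e + csize c + 2) (Suc ?e)]) @ compile c (Suc ?e) @ (Jz 0 ?e ?e # vs)"
    using while_Suc.prems by simp
  have 1: "run P (?e, s) 1 = (Suc ?e, s)"
    using while_Suc.hyps(1) P by (simp add: run_def next_conf_def)
  obtain k where k: "run P (Suc ?e, s) k = (Suc ?e + csize c, t)"
    using while_Suc.IH(1)[of "us @ [Jz r (?e + csize c + 2) (Suc ?e)]" "Jz 0 ?e ?e # vs"] P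
    by auto
  have "P ! (Suc ?e + csize c) = Jz 0 ?e ?e"
    using P by (simp add: nth_append length_compile)
  then have 2: "run P (Suc ?e + csize c, t) 1 = (?e, t)"
    using P by (simp add: run_def next_conf_def length_compile)
  obtain l where l: "run P (?e, t) l = (?e + csize (CWhile r c), u)"
    using while_Suc.IH(2)[OF while_Suc.prems] by auto
  \<comment> \<open>The test, the body, the jump back and the remaining iterations, in this
    order.\<close>
  show ?case
    using 1 k 2 l by (intro exI[of _ "((1 + k) + 1) + l"]) (simp only: run_add)
qed

lemma halted_run:
  assumes "length P \<le> fst (run P x t)" "t \<le> u"
  shows "length P \<le> fst (run P x u)"
  using assms(2,1) by (induction u rule: dec_induct) (auto simp: run_Suc next_conf_def)

definition input :: "nat \<Rightarrow> nat \<Rightarrow> nat" where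
  "input n r = (if r = 0 then n else 0)"

text \<open>The compiled program is followed by a loop that is left only if the output is zero.\<close>

lemma machine_halts_iff_0:
  obtains P where
    "\<And>n y. rec_eval g [n] y \<Longrightarrow> halts P (0, input n) \<longleftrightarrow> y = 0"
proof -
  obtain c where c: "computes g [0] 1 2 c"
    using computableD[OF all_computable, of "[0]" 2 1 g] by auto
  \<comment> \<open>Register 1 holds the output. Address \<open>csize c + 2\<close> is the length of
    \<open>P\<close>, so a jump there halts; the last instruction returns to the test.\<close>
  define P where "P = compile c 0 @ [Jz 1 (csize c + 2) (csize c + 1), Jz 0 (csize c) (csize c)]"
  have len: "length P = csize c + 2" by (simp add: P_def length_compile)
  have nth: "P ! csize c = Jz 1 (csize c + 2) (csize c + 1)"
    "P ! Suc (csize c) = Jz 0 (csize c) (csize c)"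
    by (simp_all add: P_def nth_append length_compile)
  have "halts P (0, input n) \<longleftrightarrow> y = 0" if "rec_eval g [n] y" for n y
  proof -
    let ?s = "input n"
    have r: "rec_eval g (map ?s [0]) y" using that by (simp add: input_def)
    obtain t where t: "exec c ?s t" "t 1 = y"
      using computesD[OF c, of ?s y] r by metis
    obtain k where k: "run P (0, ?s) k = (csize c, t)"
      using exec_compile[OF t(1), of P "[]"] by (auto simp: P_def)
    show ?thesis
    proof
      assume "y = 0"
      with k t(2) nth(1) have "fst (run P (0, ?s) (Suc k)) = length P"
        by (simp add: run_Suc next_conf_def len)
      then show "halts P (0, ?s)" unfolding halts_def by (metis order_refl)
    next
      assume h: "halts P (0, ?s)"
      show "y = 0"
      proof (rule ccontr)
        assume y: "y \<noteq> 0"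
        have loop: "run P (0, ?s) (k + m) \<in> {(csize c, t), (Suc (csize c), t)}" for m
          by (induction m) (use k y t(2) nth in \<open>auto simp: run_Suc next_conf_def len\<close>)
        obtain m where "length P \<le> fst (run P (0, ?s) m)" using h by (auto simp: halts_def)
        from halted_run[OF this, of "k + m"] loop[of m] show False by (auto simp: len)
      qed
    qed
  qed
  then show ?thesis using that[of P] by blast
qed

section \<open>Fluted constraints\<close>

type_synonym lit = "bool \<times> psym"

abbreviation pos :: "psym \<Rightarrow> lit" where "pos p \<equiv> (True, p)"
abbreviation neg :: "psym \<Rightarrow> lit" where "neg p \<equiv> (False, p)"

text \<open>Formulas have neither equality nor logical constants. A tautology over a nullary
  predicate serves as truth and is fluted at every level.\<close>

definition Top :: fm where
  "Top = Disj (Atom (Pred 0 0) []) (Neg (Atom (Pred 0 0) []))"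

definition big_conj :: "fm list \<Rightarrow> fm" where
  "big_conj fs = foldr Conj fs Top"

definition big_disj :: "fm list \<Rightarrow> fm" where
  "big_disj fs = foldr Disj fs (Neg Top)"

fun lit1 :: "lit \<Rightarrow> fm" where
  "lit1 (b, p) = (if b then Atom p [1] else Neg (Atom p [1]))"

definition args :: "psym \<Rightarrow> 'a \<Rightarrow> 'a \<Rightarrow> 'a list" where
  "args p x y = (if arity p = 1 then [y] else [x, y])"

fun lit2 :: "lit \<Rightarrow> fm" where
  "lit2 (b, p) = (if b then Atom p (args p 1 2) else Neg (Atom p (args p 1 2)))"

text \<open>\<open>AU\<close> stands for \<open>\<forall>x\<^sub>1 (\<And> \<longrightarrow> \<And>)\<close>, \<open>AA\<close> for \<open>\<forall>x\<^sub>1 (\<And> \<longrightarrow> \<forall>x\<^sub>2 \<Or>)\<close>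
  and \<open>AE\<close> for \<open>\<forall>x\<^sub>1 (\<And> \<longrightarrow> \<exists>x\<^sub>2 \<And>)\<close>. Unary literals in the scope of \<open>x\<^sub>2\<close> speak about \<open>x\<^sub>2\<close>.\<close>

datatype con = AU "lit list" "lit list" | AA "lit list" "lit list" | AE "lit list" "lit list"

fun con_fm :: "con \<Rightarrow> fm" where
  "con_fm (AU ls ms) = Forall 1 (Impl (big_conj (map lit1 ls)) (big_conj (map lit1 ms)))"
| "con_fm (AA ls ms) = Forall 1 (Impl (big_conj (map lit1 ls)) (Forall 2 (big_disj (map lit2 ms))))"
| "con_fm (AE ls ms) = Forall 1 (Impl (big_conj (map lit1 ls)) (Exists 2 (big_conj (map lit2 ms))))"

fun con_wf :: "con \<Rightarrow> bool" where
  "con_wf (AU ls ms) \<longleftrightarrow> (\<forall>(b, p)\<in>set (ls @ ms). arity p = 1)"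
| "con_wf (AA ls ms) \<longleftrightarrow> (\<forall>(b, p)\<in>set ls. arity p = 1) \<and> (\<forall>(b, p)\<in>set ms. arity p \<in> {1, 2})"
| "con_wf (AE ls ms) \<longleftrightarrow> (\<forall>(b, p)\<in>set ls. arity p = 1) \<and> (\<forall>(b, p)\<in>set ms. arity p \<in> {1, 2})"

fun hold1 :: "'a struct \<Rightarrow> 'a \<Rightarrow> lit \<Rightarrow> bool" where
  "hold1 M x (b, p) \<longleftrightarrow> interp M p [x] = b"

fun hold2 :: "'a struct \<Rightarrow> 'a \<Rightarrow> 'a \<Rightarrow> lit \<Rightarrow> bool" where
  "hold2 M x y (b, p) \<longleftrightarrow> interp M p (args p x y) = b"

fun holds :: "'a struct \<Rightarrow> con \<Rightarrow> bool" where
  "holds M (AU ls ms) \<longleftrightarrow> (\<forall>x\<in>universe M. list_all (hold1 M x) ls \<longrightarrow> list_all (hold1 M x) ms)"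
| "holds M (AA ls ms) \<longleftrightarrow> (\<forall>x\<in>universe M. list_all (hold1 M x) ls \<longrightarrow>
     (\<forall>y\<in>universe M. list_ex (hold2 M x y) ms))"
| "holds M (AE ls ms) \<longleftrightarrow> (\<forall>x\<in>universe M. list_all (hold1 M x) ls \<longrightarrow>
     (\<exists>y\<in>universe M. list_all (hold2 M x y) ms))"

lemma sat_big_conj: "sat M v (big_conj fs) \<longleftrightarrow> list_all (sat M v) fs"
  by (induction fs) (auto simp: big_conj_def Top_def)

lemma sat_big_disj: "sat M v (big_disj fs) \<longleftrightarrow> list_ex (sat M v) fs"
  by (induction fs) (auto simp: big_disj_def Top_def)

lemma sat_lit1: "sat M v (lit1 l) \<longleftrightarrow> hold1 M (v 1) l"
  by (cases l) auto

lemma sat_lit2: "sat M v (lit2 l) \<longleftrightarrow> hold2 M (v 1) (v 2) l"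
  by (cases l) (auto simp: args_def)

lemma sat_con_fm: "sat M v (con_fm c) \<longleftrightarrow> holds M c"
  by (cases c) (simp_all add: sat_big_conj sat_big_disj list_all_iff list_ex_iff
      sat_lit1 sat_lit2 del: lit1.simps lit2.simps hold1.simps hold2.simps)

lemma fluted_Top: "fluted m Top"
  unfolding Top_def using fluted.atom[of "m + 1" m "Pred 0 0"]
  by (auto intro!: fluted.disj fluted.neg)

lemma fluted_big_conj: "(\<And>f. f \<in> set fs \<Longrightarrow> fluted m f) \<Longrightarrow> fluted m (big_conj fs)"
  by (induction fs) (auto simp: big_conj_def fluted_Top intro: fluted.conj)

lemma fluted_big_disj: "(\<And>f. f \<in> set fs \<Longrightarrow> fluted m f) \<Longrightarrow> fluted m (big_disj fs)"
  by (induction fs) (auto simp: big_disj_def fluted_Top intro: fluted.disj fluted.neg)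

lemma fluted_Atom1: "arity p = 1 \<Longrightarrow> fluted 1 (Atom p [1])"
  using fluted.atom[of 1 1 p] by simp

lemma fluted_Atom2: "arity p \<in> {1, 2} \<Longrightarrow> fluted 2 (Atom p (args p 1 2))"
  using fluted.atom[of 2 2 p] fluted.atom[of 1 2 p] by (auto simp: args_def upt_rec numeral_2_eq_2)

lemma fluted_lit1: "arity (snd l) = 1 \<Longrightarrow> fluted 1 (lit1 l)"
  using fluted_Atom1 by (cases l) (auto intro: fluted.neg)

lemma fluted_lit2: "arity (snd l) \<in> {1, 2} \<Longrightarrow> fluted 2 (lit2 l)"
  using fluted_Atom2 by (cases l) (auto intro: fluted.neg)

lemma fluted_Forall1: "fluted 1 f \<Longrightarrow> fluted 0 (Forall 1 f)"
  and fluted_Exists1: "fluted 1 f \<Longrightarrow> fluted 0 (Exists 1 f)"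
  and fluted_Forall2: "fluted 2 f \<Longrightarrow> fluted 1 (Forall 2 f)"
  and fluted_Exists2: "fluted 2 f \<Longrightarrow> fluted 1 (Exists 2 f)"
  using fluted.all[of 0 f] fluted.ex[of 0 f] fluted.all[of 1 f] fluted.ex[of 1 f]
  by (simp_all add: numeral_2_eq_2)

lemma fluted_con_fm: "con_wf c \<Longrightarrow> fluted 0 (con_fm c)"
proof (cases c)
  case (AU ls ms)
  assume "con_wf c"
  then show ?thesis unfolding AU con_fm.simps
    by (intro fluted_Forall1 fluted.impl fluted_big_conj) (auto simp: AU intro!: fluted_lit1 simp del: lit1.simps One_nat_def)
next
  case (AA ls ms)
  assume "con_wf c"
  then show ?thesis unfolding AA con_fm.simps
    by (intro fluted_Forall1 fluted.impl fluted_big_conj fluted_Forall2 fluted_big_disj)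
      (auto simp: AA intro!: fluted_lit1 fluted_lit2 simp del: lit1.simps lit2.simps One_nat_def)
next
  case (AE ls ms)
  assume "con_wf c"
  then show ?thesis unfolding AE con_fm.simps
    by (intro fluted_Forall1 fluted.impl fluted_big_conj fluted_Exists2)
      (auto simp: AE intro!: fluted_lit1 fluted_lit2 simp del: lit1.simps lit2.simps One_nat_def)
qed

lemma vars_big_conj: "vars (big_conj fs) = (\<Union>f\<in>set fs. vars f)"
  by (induction fs) (auto simp: big_conj_def Top_def)

lemma vars_big_disj: "vars (big_disj fs) = (\<Union>f\<in>set fs. vars f)"
  by (induction fs) (auto simp: big_disj_def Top_def)

lemma vars_lit: "vars (lit1 l) \<subseteq> {1, 2}" "vars (lit2 l) \<subseteq> {1, 2}"
  by (cases l; auto simp: args_def)+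

lemma vars_con_fm: "vars (con_fm c) \<subseteq> {1, 2}"
  by (cases c) (simp_all add: vars_big_conj vars_big_disj UN_subset_iff vars_lit
      del: lit1.simps lit2.simps One_nat_def)

section \<open>The sentence describing a machine\<close>

definition T :: "nat \<Rightarrow> psym" where
  "T k = [T1, T2, T3] ! (k mod 3)"

definition unary :: "nat \<Rightarrow> nat \<Rightarrow> psym" where
  "unary t i = Pred 1 (prod_encode (t, i))"

definition Row :: "nat \<Rightarrow> psym" where "Row j = unary 0 (j mod 3)"
text \<open>Counting columns modulo 4 rather than 2 gives the right neighbour (type
  \<open>c + 1\<close>) and the left neighbour (type \<open>c + 3\<close>) of a column different
  types.\<close>

definition Col :: "nat \<Rightarrow> psym" where "Col c = unary 1 (c mod 4)"
definition Start :: psym where "Start = unary 2 0"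
definition Bottom :: psym where "Bottom = unary 2 1"
definition First :: psym where "First = unary 2 2"
definition At :: "nat \<Rightarrow> psym" where "At q = unary 3 q"
definition Below :: "nat \<Rightarrow> psym" where "Below r = unary 4 r"
text \<open>\<open>Below r\<close> marks the columns smaller than the value of register
  \<open>r\<close>. \<open>BelowL r\<close> and \<open>BelowR r\<close> are its shifts by one
  column, that is, the marks for the value increased and decreased by one.\<close>

definition BelowL :: "nat \<Rightarrow> psym" where "BelowL r = unary 5 r"
definition BelowR :: "nat \<Rightarrow> psym" where "BelowR r = unary 6 r"
text \<open>Constant along a row, so that every point can carry out a jump test locally.\<close>

definition IsZero :: "nat \<Rightarrow> psym" where "IsZero r = unary 7 r"
definition Togo :: "nat \<Rightarrow> psym" where "Togo i = unary 8 i"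

definition Rt :: psym where "Rt = Pred 2 0"
definition Lf :: psym where "Lf = Pred 2 1"
definition Up :: psym where "Up = Pred 2 2"

lemmas psym_defs = T_def unary_def Row_def Col_def Start_def Bottom_def First_def At_def Below_def
  BelowL_def BelowR_def IsZero_def Togo_def Rt_def Lf_def Up_def

section \<open>Constraints that force the grid\<close>

definition bottom_con :: "nat \<Rightarrow> con" where
  "bottom_con c = AE [pos Bottom, pos (Col c)]
     [pos Rt, pos (T (if even c then 1 else 0)), pos Bottom, pos (Row 0), pos (Col (c + 1))]"

text \<open>Aimed at the diagonals of squares: transitivity puts them into \<open>T (j + 1)\<close>,
  and this constraint then keeps them out of \<open>T j\<close>.\<close>

definition disjoint_con :: "nat \<Rightarrow> nat \<Rightarrow> nat \<Rightarrow> con" where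
  "disjoint_con j c d = AA [pos (Row j), pos (Col c)]
     [neg (Row (j + 1)), neg (Col d), neg (T (j + 1)), neg (T j)]"

text \<open>Clause form of "\<open>T (j + 2)\<close>, or both \<open>T (j + 1)\<close> and a
  horizontal edge": \<open>p\<close> ranges over the two conjuncts. Modulo 3,
  \<open>T (j + 2)\<close> is \<open>T (j - 1)\<close>. The values 1 and 3 of \<open>d\<close> stand
  for the right and the left neighbour.\<close>

definition cover_con :: "nat \<Rightarrow> nat \<Rightarrow> nat \<Rightarrow> psym \<Rightarrow> con" where
  "cover_con j c d p = AA [pos (Row j), pos (Col c)]
     [neg (Row j), neg (Col (c + d)), pos (T (j + 2)), pos p]"

text \<open>For the squares over the bottom edges that leave odd columns. There the upward edge of
  the odd column, which is in \<open>T 1\<close>, takes the place of the diagonal.\<close>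

definition bottom_disjoint_con :: "nat \<Rightarrow> con" where
  "bottom_disjoint_con c = AA [pos (Row 0), pos (Col c)]
     [neg (Row 1), neg (Col c), neg (T 1), neg (T 0)]"

definition up_con :: "nat \<Rightarrow> nat \<Rightarrow> nat \<Rightarrow> con" where
  "up_con q j c = AE [pos (Row j), pos (Col c), pos (At q)]
     [pos Up, pos (T (if even c then j else j + 1)), pos (Row (j + 1)), pos (Col c)]"

definition grid_cons :: "con list" where
  "grid_cons =
     map bottom_con [0..<4] @
     [disjoint_con j c d. j \<leftarrow> [0..<3], c \<leftarrow> [0, 2], d \<leftarrow> [1, 3]] @
     [cover_con j c 1 p. j \<leftarrow> [0..<3], c \<leftarrow> [0, 2], p \<leftarrow> [T (j + 1), Rt]] @
     [cover_con j c 3 p. j \<leftarrow> [0..<3], c \<leftarrow> [0, 2], p \<leftarrow> [T (j + 1), Lf]] @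
     map bottom_disjoint_con [1, 3]"

section \<open>Constraints for the run and the input\<close>

definition horizontal :: "nat \<Rightarrow> (lit \<times> lit) list" where
  "horizontal r =
     [(pos (IsZero r), pos (IsZero r)), (neg (IsZero r), neg (IsZero r)),
      (pos (Below r), pos (BelowL r)), (neg (Below r), neg (BelowL r)),
      (pos (BelowR r), pos (Below r)), (neg (BelowR r), neg (Below r)),
      (neg (Below r), neg (Below r))]"

fun negate :: "lit \<Rightarrow> lit" where
  "negate (b, p) = (\<not> b, p)"

text \<open>The predicate whose value at a point becomes \<open>Below r\<close> at the point above.
  Upward constraints only copy single bits; the shift needed for a change of the register has been
  made along the row.\<close>

fun source :: "instr \<Rightarrow> nat \<Rightarrow> psym" where
  "source (Inc r') r = (if r = r' then BelowL r else Below r)"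
| "source (Dec r') r = (if r = r' then BelowR r else Below r)"
| "source (Jz r' p q) r = Below r"

fun jump_cons :: "nat \<Rightarrow> instr \<Rightarrow> con list" where
  "jump_cons q (Inc r) = [AA [pos (At q)] [neg Up, pos (At (Suc q))]]"
| "jump_cons q (Dec r) = [AA [pos (At q)] [neg Up, pos (At (Suc q))]]"
| "jump_cons q (Jz r p p') =
     [AA [pos (At q), pos (IsZero r)] [neg Up, pos (At p)],
      AA [pos (At q), neg (IsZero r)] [neg Up, pos (At p')]]"

definition copy_con :: "nat \<Rightarrow> bool \<Rightarrow> psym \<Rightarrow> nat \<Rightarrow> con" where
  "copy_con q b p r = AA [pos (At q), (b, p)] [neg Up, (b, Below r)]"

text \<open>Register \<open>K\<close> is a clock: it is increased in every step.\<close>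

definition step_cons :: "nat \<Rightarrow> nat \<Rightarrow> instr \<Rightarrow> con list" where
  "step_cons K q I = jump_cons q I @
     [up_con q j c. j \<leftarrow> [0..<3], c \<leftarrow> [0..<4]] @
     [copy_con q b (if r = K then BelowL r else source I r) r. r \<leftarrow> [0..<Suc K], b \<leftarrow> [True, False]]"

text \<open>A pair in \<open>horizontal r\<close> leads from a point to its right neighbour. Edges
  of \<open>Lf\<close> run from right to left, so along them the contrapositive is stated. The
  leftmost column has no left neighbour and is fixed through \<open>First\<close>.\<close>

definition bit_cons :: "nat \<Rightarrow> con list" where
  "bit_cons r =
     [AA [fst c] [neg Rt, snd c]. c \<leftarrow> horizontal r] @
     [AA [negate (snd c)] [neg Lf, negate (fst c)]. c \<leftarrow> horizontal r] @
     [AU [pos First] [pos (BelowL r)],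
      AU [pos First, pos (Below r)] [neg (IsZero r)],
      AU [pos First, neg (Below r)] [pos (IsZero r)]]"

definition start_cons :: "nat \<Rightarrow> con list" where
  "start_cons K =
     [AU [pos Start] [pos Bottom, pos (Row 0), pos (Col 0), pos First],
      AA [pos First] [neg Up, pos First],
      AU [pos Bottom] (pos (At 0) # [neg (Below r). r \<leftarrow> [1..<Suc K]]),
      AU [pos (Togo 0)] [neg (Below 0)]]"

lemmas con_defs = bottom_con_def disjoint_con_def cover_con_def bottom_disjoint_con_def up_con_def
  copy_con_def

definition machine_cons :: "instr list \<Rightarrow> nat \<Rightarrow> con list" where
  "machine_cons P K = grid_cons @ start_cons K @ concat (map bit_cons [0..<Suc K]) @
     concat (map (\<lambda>q. step_cons K q (P ! q)) [0..<length P])"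

definition machine_fm :: "instr list \<Rightarrow> nat \<Rightarrow> fm" where
  "machine_fm P K = big_conj (map con_fm (machine_cons P K))"

text \<open>\<open>Togo i\<close> says that \<open>i\<close> marks of register 0 are still to come.
  The countdown begins with \<open>n\<close> at the start point, and \<open>Togo 0\<close> forbids a
  further mark.\<close>

definition count_fm :: "nat \<Rightarrow> fm" where
  "count_fm i = Forall 1 (Impl (Atom (Togo (Suc i)) [1])
     (Conj (Atom (Below 0) [1]) (Forall 2 (Impl (Atom Rt [1, 2]) (Atom (Togo i) [2])))))"

primrec counts_fm :: "nat \<Rightarrow> fm" where
  "counts_fm 0 = Top"
| "counts_fm (Suc i) = Conj (count_fm i) (counts_fm i)"

text \<open>The machine does not occur here. The code of the conjunction with
  \<open>machine_fm\<close> is thus a pairing of a machine part with a number computable from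
  \<open>n\<close> alone.\<close>

definition input_fm :: "nat \<Rightarrow> fm" where
  "input_fm n = Conj (Exists 1 (Conj (Atom (Togo n) [1]) (Atom Start [1]))) (counts_fm n)"

lemma arity_bits [simp]:
  "arity (T k) = 2" "arity (unary t i) = 1" "arity (Row k) = 1" "arity (Col k) = 1"
  "arity Start = 1" "arity Bottom = 1" "arity First = 1" "arity (At k) = 1" "arity (Below k) = 1"
  "arity (BelowL k) = 1" "arity (BelowR k) = 1" "arity (IsZero k) = 1" "arity (Togo k) = 1"
  "arity Rt = 2" "arity Lf = 2" "arity Up = 2"
proof -
  have "k mod 3 = 0 \<or> k mod 3 = 1 \<or> k mod 3 = 2" by linarith
  then show "arity (T k) = 2" by (auto simp: T_def)
qed (simp_all add: psym_defs)

lemma machine_cons_wf: "c \<in> set (machine_cons P K) \<Longrightarrow> con_wf c"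
proof -
  have "con_wf c" if "c \<in> set grid_cons" using that by (auto simp: grid_cons_def con_defs)
  moreover have "con_wf c" if "c \<in> set (start_cons K)" using that by (auto simp: start_cons_def)
  moreover have "con_wf c" if "c \<in> set (bit_cons r)" for r
    using that by (auto simp: bit_cons_def horizontal_def)
  moreover have "con_wf c" if "c \<in> set (step_cons K q I)" for q I
    using that by (cases I) (auto simp: step_cons_def con_defs split: if_splits)
  moreover assume "c \<in> set (machine_cons P K)"
  ultimately show ?thesis by (auto simp: machine_cons_def simp del: upt_Suc)
qed

lemma input_machine_fm_in_FL2_3T: "Conj (machine_fm P K) (input_fm n) \<in> FL2_3T"
proof -
  have "fluted 0 (machine_fm P K)"
    unfolding machine_fm_def using machine_cons_wf fluted_con_fm
    by (intro fluted_big_conj) auto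
  moreover have "fluted 0 (count_fm i)" for i
    unfolding count_fm_def
    using fluted_Atom2[of Rt] fluted_Atom2[of "Togo i"]
    by (intro fluted_Forall1 fluted.impl fluted.conj fluted_Forall2 fluted_Atom1)
      (simp_all add: args_def)
  then have "fluted 0 (counts_fm i)" for i
    by (induction i) (auto intro: fluted.conj fluted_Top)
  then have "fluted 0 (input_fm n)"
    unfolding input_fm_def by (intro fluted.conj fluted_Exists1 fluted_Atom1) auto
  ultimately have fl: "fluted 0 (Conj (machine_fm P K) (input_fm n))" by (rule fluted.conj)
  have "vars (machine_fm P K) \<subseteq> {1, 2}"
    using vars_con_fm by (auto simp: machine_fm_def vars_big_conj)
  moreover have "vars (counts_fm i) \<subseteq> {1, 2}" for i
    by (induction i) (auto simp: count_fm_def Top_def)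
  ultimately have "vars (Conj (machine_fm P K) (input_fm n)) \<subseteq> {1, 2}"
    by (auto simp: input_fm_def)
  from card_mono[OF _ this] fl show ?thesis by (simp add: FL2_3T_def)
qed

lemma sat_machine_fm: "sat M v (machine_fm P K) \<longleftrightarrow> (\<forall>c\<in>set (machine_cons P K). holds M c)"
  by (simp add: machine_fm_def sat_big_conj list_all_iff sat_con_fm)

definition counting :: "'a struct \<Rightarrow> nat \<Rightarrow> bool" where
  "counting M i \<longleftrightarrow> (\<forall>x\<in>universe M. interp M (Togo (Suc i)) [x] \<longrightarrow> interp M (Below 0) [x] \<and>
      (\<forall>y\<in>universe M. interp M Rt [x, y] \<longrightarrow> interp M (Togo i) [y]))"

lemma sat_count_fm: "sat M v (count_fm i) \<longleftrightarrow> counting M i"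
  by (simp add: count_fm_def counting_def)

lemma sat_input_fm: "sat M v (input_fm n) \<longleftrightarrow>
    (\<exists>x\<in>universe M. interp M (Togo n) [x] \<and> interp M Start [x]) \<and> (\<forall>i<n. counting M i)"
proof -
  have "sat M v (counts_fm n) \<longleftrightarrow> (\<forall>i<n. counting M i)"
    by (induction n) (simp_all add: sat_count_fm All_less_Suc, simp add: Top_def)
  then show ?thesis by (simp add: input_fm_def)
qed

section \<open>Finite models force the machine to halt\<close>

lemma Row_mod [simp]: "Row (j mod 3) = Row j" "Row (Suc (j mod 3)) = Row (Suc j)"
  by (simp_all add: Row_def mod_Suc_eq)

lemma Col_mod [simp]: "Col (c mod 4) = Col c" "Col (Suc (c mod 4)) = Col (Suc c)"
  by (simp_all add: Col_def mod_Suc_eq)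

lemma T_mod [simp]: "T (j mod 3) = T j" "T (Suc (j mod 3)) = T (Suc j)"
    "T (Suc (Suc (j mod 3))) = T (Suc (Suc j))"
  by (simp_all add: T_def mod_Suc_eq) (metis mod_Suc_eq)

lemma T_add_3 [simp]: "T (Suc (Suc (Suc k))) = T k"
proof -
  have "Suc (Suc (Suc k)) = k + 3" by simp
  then show ?thesis by (simp only: T_def mod_add_self2)
qed

lemma Col_add_4 [simp]: "Col (Suc (Suc (Suc (Suc k)))) = Col k"
proof -
  have "Suc (Suc (Suc (Suc k))) = k + 4" by simp
  then show ?thesis by (simp only: Col_def mod_add_self2)
qed

lemma even_mod_4: "even (c mod 4) \<longleftrightarrow> even (c::nat)"
  by presburger

lemma mod_4_cases:
  fixes c :: nat
  shows "even c \<Longrightarrow> c mod 4 \<in> set [0, 2]" "odd c \<Longrightarrow> c mod 4 \<in> set [1, 3]"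
  by (simp; presburger)+

lemma list_all_map: "list_all Q (map f xs) \<longleftrightarrow> (\<forall>x\<in>set xs. Q (f x))"
  and list_all_concat: "list_all Q (concat xss) \<longleftrightarrow> (\<forall>xs\<in>set xss. list_all Q xs)"
  and ball_set_map: "(\<forall>y\<in>set (map g xs). R y) \<longleftrightarrow> (\<forall>x\<in>set xs. R (g x))"
  by (auto simp: list_all_iff)

fun register :: "instr \<Rightarrow> nat" where
  "register (Inc r) = r"
| "register (Dec r) = r"
| "register (Jz r p q) = r"

lemma arity_horizontal: "(c, d) \<in> set (horizontal r) \<Longrightarrow> arity (snd c) = 1 \<and> arity (snd d) = 1"
  by (auto simp: horizontal_def)

text \<open>The situation to be refuted: a finite model of the sentence for a run that never halts.
  All registers of the program are smaller than \<open>K\<close>, which leaves \<open>K\<close> to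
  the clock.\<close>

locale machine_model =
  fixes M :: "'a struct" and P :: "instr list" and K n :: nat
  assumes finite: "finite (universe M)"
    and trans: "transitive_in M (T k)"
    and cons: "c \<in> set (machine_cons P K) \<Longrightarrow> holds M c"
    and counts: "i < n \<Longrightarrow> counting M i"
    and start: "\<exists>x\<in>universe M. interp M (Togo n) [x] \<and> interp M Start [x]"
    and registers: "I \<in> set P \<Longrightarrow> register I < K"
    and K: "0 < K"
    and running: "fst (run P (0, input n) t) < length P"
begin

abbreviation U :: "'a set" where "U \<equiv> universe M"
abbreviation u :: "psym \<Rightarrow> 'a \<Rightarrow> bool" where "u p x \<equiv> interp M p [x]"
abbreviation e :: "psym \<Rightarrow> 'a \<Rightarrow> 'a \<Rightarrow> bool" where "e p x y \<equiv> interp M p [x, y]"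

section \<open>What the constraints say about points and pairs\<close>

lemma T_trans: "e (T k) x y \<Longrightarrow> e (T k) y z \<Longrightarrow> x \<in> U \<Longrightarrow> y \<in> U \<Longrightarrow> z \<in> U \<Longrightarrow> e (T k) x z"
  using trans[of k] unfolding transitive_in_def transp_on_def by blast

lemma AA_D: "holds M (AA ls ms) \<Longrightarrow> x \<in> U \<Longrightarrow> y \<in> U \<Longrightarrow> list_all (hold1 M x) ls \<Longrightarrow>
    list_ex (hold2 M x y) ms"
  by simp

lemma machine_cons:
  "list_all (holds M) grid_cons"
  "list_all (holds M) (start_cons K)"
  "\<forall>r\<in>{0..<Suc K}. list_all (holds M) (bit_cons r)"
  "\<forall>q\<in>{0..<length P}. list_all (holds M) (step_cons K q (P ! q))"
proof -
  have "list_all (holds M) (machine_cons P K)" using cons by (simp add: list_all_iff)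
  then show "list_all (holds M) grid_cons"
    "list_all (holds M) (start_cons K)"
    "\<forall>r\<in>{0..<Suc K}. list_all (holds M) (bit_cons r)"
    "\<forall>q\<in>{0..<length P}. list_all (holds M) (step_cons K q (P ! q))"
    unfolding machine_cons_def list_all_append list_all_concat ball_set_map set_upt
    by - (elim conjE, assumption)+
qed

lemma grid_cons:
  "\<forall>c\<in>{0..<4}. holds M (bottom_con c)"
  "\<forall>j\<in>{0..<3}. \<forall>c\<in>set [0, 2]. \<forall>d\<in>set [1, 3]. holds M (disjoint_con j c d)"
  "\<forall>j\<in>{0..<3}. \<forall>c\<in>set [0, 2]. \<forall>p\<in>set [T (j + 1), Rt]. holds M (cover_con j c 1 p)"
  "\<forall>j\<in>{0..<3}. \<forall>c\<in>set [0, 2]. \<forall>p\<in>set [T (j + 1), Lf]. holds M (cover_con j c 3 p)"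
  "\<forall>c\<in>set [1, 3]. holds M (bottom_disjoint_con c)"
  using machine_cons(1)
  unfolding grid_cons_def list_all_append list_all_concat list_all_map ball_set_map set_upt
  by - (elim conjE, assumption)+

lemma bottom_next:
  assumes "x \<in> U" "u Bottom x" "u (Col c) x"
  shows "\<exists>y\<in>U. e Rt x y \<and> e (T (if even c then 1 else 0)) x y \<and> u Bottom y \<and> u (Row 0) y \<and>
    u (Col (Suc c)) y"
proof -
  let ?c = "c mod 4"
  have "?c \<in> {0..<4}" by simp
  from grid_cons(1)[THEN bspec, OF this] show ?thesis
    using assms by (simp add: args_def even_mod_4 bottom_con_def)
qed

lemma colours_disjoint:
  assumes "x \<in> U" "y \<in> U" "u (Row j) x" "u (Col c) x" "even c" "u (Row (Suc j)) y" "u (Col d) y" "odd d"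
    "e (T (Suc j)) x y"
  shows "\<not> e (T j) x y"
proof -
  let ?j = "j mod 3" and ?c = "c mod 4" and ?d = "d mod 4"
  have "?j \<in> {0..<3}" by simp
  from grid_cons(2)[rule_format, OF this mod_4_cases(1)[OF assms(5)] mod_4_cases(2)[OF assms(8)]]
  show ?thesis using assms by (simp add: args_def disjoint_con_def)
qed

lemma colours_cover:
  assumes "x \<in> U" "y \<in> U" "u (Row j) x" "u (Col c) x" "even c" "u (Row j) y" "u (Col (c + d)) y"
    "d = 1 \<and> E = Rt \<or> d = 3 \<and> E = Lf" "\<not> e (T (j + 2)) x y"
  shows "e (T (Suc j)) x y" "e E x y"
proof -
  let ?j = "j mod 3" and ?c = "c mod 4"
  have j: "?j \<in> {0..<3}" by simp
  have C: "holds M (cover_con ?j ?c d p)" if "p \<in> set [T (?j + 1), E]" for p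
    using that assms(8) grid_cons(3)[rule_format, OF j mod_4_cases(1)[OF assms(5)], of p]
      grid_cons(4)[rule_format, OF j mod_4_cases(1)[OF assms(5)], of p] by blast
  have "Col (?c + d) = Col (c + d)" by (simp add: Col_def mod_add_left_eq)
  moreover have "arity E = 2" using assms(8) by auto
  ultimately show "e (T (Suc j)) x y" "e E x y"
    using C[of "T (?j + 1)"] C[of E] assms(1-7,9)
    by (simp add: args_def cover_con_def, blast)+
qed

lemma colours_bottom:
  assumes "x \<in> U" "y \<in> U" "u (Row 0) x" "u (Col c) x" "odd c" "u (Row 1) y" "u (Col c) y" "e (T 1) x y"
  shows "\<not> e (T 0) x y"
proof -
  let ?c = "c mod 4"
  from grid_cons(5)[rule_format, OF mod_4_cases(2)[OF assms(5)]]
  show ?thesis using assms by (simp add: args_def bottom_disjoint_con_def)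
qed

lemma start_cons:
  "holds M (AU [pos Start] [pos Bottom, pos (Row 0), pos (Col 0), pos First])"
  "holds M (AA [pos First] [neg Up, pos First])"
  "holds M (AU [pos Bottom] (pos (At 0) # [neg (Below r). r \<leftarrow> [1..<Suc K]]))"
  "holds M (AU [pos (Togo 0)] [neg (Below 0)])"
  using machine_cons(2) unfolding start_cons_def list.pred_inject by blast+

lemma startD: "x \<in> U \<Longrightarrow> u Start x \<Longrightarrow> u Bottom x \<and> u (Row 0) x \<and> u (Col 0) x \<and> u First x"
  using start_cons(1) by simp

lemma First_up: "x \<in> U \<Longrightarrow> y \<in> U \<Longrightarrow> u First x \<Longrightarrow> e Up x y \<Longrightarrow> u First y"
  using AA_D[OF start_cons(2), of x y] by (simp add: args_def)

lemma Togo_0: "x \<in> U \<Longrightarrow> u (Togo 0) x \<Longrightarrow> \<not> u (Below 0) x"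
  using start_cons(4) by simp

lemma bottom_At: "x \<in> U \<Longrightarrow> u Bottom x \<Longrightarrow> u (At 0) x"
  and bottom_Below: "x \<in> U \<Longrightarrow> u Bottom x \<Longrightarrow> 0 < r \<Longrightarrow> r \<le> K \<Longrightarrow> \<not> u (Below r) x"
  using start_cons(3) by (auto simp: list_all_iff Suc_le_eq simp del: upt_Suc)

lemma bit_cons:
  assumes "r \<le> K"
  shows "\<forall>c\<in>set (horizontal r). holds M (AA [fst c] [neg Rt, snd c])"
    "\<forall>c\<in>set (horizontal r). holds M (AA [negate (snd c)] [neg Lf, negate (fst c)])"
    "list_all (holds M) [AU [pos First] [pos (BelowL r)],
      AU [pos First, pos (Below r)] [neg (IsZero r)],
      AU [pos First, neg (Below r)] [pos (IsZero r)]]"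
proof -
  have "list_all (holds M) (bit_cons r)" using machine_cons(3) assms by simp
  then show "\<forall>c\<in>set (horizontal r). holds M (AA [fst c] [neg Rt, snd c])"
    "\<forall>c\<in>set (horizontal r). holds M (AA [negate (snd c)] [neg Lf, negate (fst c)])"
    "list_all (holds M) [AU [pos First] [pos (BelowL r)],
      AU [pos First, pos (Below r)] [neg (IsZero r)],
      AU [pos First, neg (Below r)] [pos (IsZero r)]]"
    unfolding bit_cons_def list_all_append list_all_map
    by - (elim conjE, assumption)+
qed

lemma FirstD:
  assumes "x \<in> U" "r \<le> K" "u First x"
  shows "u (BelowL r) x" "u (IsZero r) x \<longleftrightarrow> \<not> u (Below r) x"
  using bit_cons(3)[OF assms(2)] assms by (simp, simp, blast)

lemma horizontalD:
  assumes "(c, d) \<in> set (horizontal r)" "r \<le> K" "x \<in> U" "y \<in> U" "e Rt x y \<or> e Lf y x" "hold1 M x c"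
  shows "hold1 M y d"
proof -
  have h: "holds M (AA [c] [neg Rt, d])" "holds M (AA [negate d] [neg Lf, negate c])"
    using bit_cons(1,2)[OF assms(2), THEN bspec, OF assms(1)] by (simp_all only: fst_conv snd_conv)
  obtain b p b' p' where "c = (b, p)" "d = (b', p')" by force
  then show ?thesis
    using AA_D[OF h(1), of x y] AA_D[OF h(2), of y x] assms(3-6) arity_horizontal[OF assms(1)]
    by (auto simp: args_def)
qed

lemma step_cons:
  assumes "q < length P"
  shows "list_all (holds M) (jump_cons q (P ! q))"
    "\<forall>j\<in>{0..<3}. \<forall>c\<in>{0..<4}. holds M (up_con q j c)"
    "\<forall>r\<in>{0..<Suc K}. \<forall>b\<in>set [True, False].
       holds M (copy_con q b (if r = K then BelowL r else source (P ! q) r) r)"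
proof -
  have "list_all (holds M) (step_cons K q (P ! q))" using machine_cons(4) assms by simp
  then show "list_all (holds M) (jump_cons q (P ! q))"
    "\<forall>j\<in>{0..<3}. \<forall>c\<in>{0..<4}. holds M (up_con q j c)"
    "\<forall>r\<in>{0..<Suc K}. \<forall>b\<in>set [True, False].
       holds M (copy_con q b (if r = K then BelowL r else source (P ! q) r) r)"
    unfolding step_cons_def list_all_append list_all_concat list_all_map ball_set_map set_upt
    by - (elim conjE, assumption)+
qed

lemma up_next:
  assumes "x \<in> U" "u (Row j) x" "u (Col c) x" "u (At q) x" "q < length P"
  shows "\<exists>y\<in>U. e Up x y \<and> e (T (if even c then j else Suc j)) x y \<and> u (Row (Suc j)) y \<and> u (Col c) y"
proof -
  let ?j = "j mod 3" and ?c = "c mod 4"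
  have "?j \<in> {0..<3}" "?c \<in> {0..<4}" by simp_all
  from step_cons(2)[OF assms(5), rule_format, OF this] show ?thesis
    using assms by (simp add: args_def even_mod_4 up_con_def split: if_splits)
qed

lemma Below_up:
  assumes "x \<in> U" "y \<in> U" "e Up x y" "u (At q) x" "q < length P" "r \<le> K"
  shows "u (Below r) y \<longleftrightarrow> u (if r = K then BelowL r else source (P ! q) r) x"
proof -
  let ?p = "if r = K then BelowL r else source (P ! q) r"
  have "r \<in> {0..<Suc K}" using assms(6) by simp
  then have "holds M (copy_con q b ?p r)" for b
    using step_cons(3)[OF assms(5), rule_format, of r b] by (cases b) simp_all
  from this[of True] this[of False]
  show ?thesis using assms(1-4) by (auto simp: args_def copy_con_def)
qed

lemma At_up:
  assumes "x \<in> U" "y \<in> U" "e Up x y" "u (At q) x" "q < length P"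
    "\<And>r. r < K \<Longrightarrow> u (IsZero r) x \<longleftrightarrow> s r = 0"
  shows "u (At (fst (step (P ! q) (q, s)))) y"
proof -
  have "register (P ! q) < K" using registers assms(5) by simp
  then show ?thesis
    using step_cons(1)[OF assms(5)] assms by (cases "P ! q") (auto simp: args_def)
qed

section \<open>Choice of a grid in the model\<close>

definition right :: "nat \<Rightarrow> 'a \<Rightarrow> 'a" where
  "right c x = (SOME y. y \<in> U \<and> e Rt x y \<and> e (T (if even c then 1 else 0)) x y \<and> u Bottom y \<and>
     u (Row 0) y \<and> u (Col (Suc c)) y)"

primrec bottom :: "nat \<Rightarrow> 'a" where
  "bottom 0 = (SOME x. x \<in> U \<and> u (Togo n) x \<and> u Start x)"
| "bottom (Suc i) = right i (bottom i)"

definition up :: "nat \<Rightarrow> nat \<Rightarrow> 'a \<Rightarrow> 'a" where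
  "up c j x = (SOME y. y \<in> U \<and> e Up x y \<and> e (T (if even c then j else Suc j)) x y \<and>
     u (Row (Suc j)) y \<and> u (Col c) y)"

primrec column :: "nat \<Rightarrow> 'a \<Rightarrow> nat \<Rightarrow> 'a" where
  "column c x 0 = x"
| "column c x (Suc j) = up c j (column c x j)"

text \<open>A column depends on \<open>i\<close> only through its type modulo 4 and its bottom
  point. Hence there are finitely many columns in a finite model, although \<open>i\<close> is
  unbounded.\<close>

definition cell :: "nat \<Rightarrow> nat \<Rightarrow> 'a" where
  "cell i j = column (i mod 4) (bottom i) j"

definition conf :: "nat \<Rightarrow> nat \<times> (nat \<Rightarrow> nat)" where
  "conf t = run P (0, input n) t"

definition reg :: "nat \<Rightarrow> nat \<Rightarrow> nat" where
  "reg r t = (if r = K then t else snd (conf t) r)"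

lemma right:
  assumes "x \<in> U" "u Bottom x" "u (Col c) x"
  shows "right c x \<in> U" "e Rt x (right c x)" "e (T (if even c then 1 else 0)) x (right c x)"
    "u Bottom (right c x)" "u (Row 0) (right c x)" "u (Col (Suc c)) (right c x)"
proof -
  have "right c x \<in> U \<and> e Rt x (right c x) \<and> e (T (if even c then 1 else 0)) x (right c x) \<and>
      u Bottom (right c x) \<and> u (Row 0) (right c x) \<and> u (Col (Suc c)) (right c x)"
    unfolding right_def by (rule someI_ex) (rule bottom_next[OF assms, unfolded Bex_def])
  then show "right c x \<in> U" "e Rt x (right c x)" "e (T (if even c then 1 else 0)) x (right c x)"
    "u Bottom (right c x)" "u (Row 0) (right c x)" "u (Col (Suc c)) (right c x)"
    by - (elim conjE, assumption)+
qed

lemma up: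
  assumes "x \<in> U" "u (Row j) x" "u (Col c) x" "u (At q) x" "q < length P"
  shows "up c j x \<in> U" "e Up x (up c j x)" "e (T (if even c then j else Suc j)) x (up c j x)"
    "u (Row (Suc j)) (up c j x)" "u (Col c) (up c j x)"
proof -
  have "up c j x \<in> U \<and> e Up x (up c j x) \<and> e (T (if even c then j else Suc j)) x (up c j x) \<and>
      u (Row (Suc j)) (up c j x) \<and> u (Col c) (up c j x)"
    unfolding up_def by (rule someI_ex) (rule up_next[OF assms, unfolded Bex_def])
  then show "up c j x \<in> U" "e Up x (up c j x)" "e (T (if even c then j else Suc j)) x (up c j x)"
    "u (Row (Suc j)) (up c j x)" "u (Col c) (up c j x)"
    by - (elim conjE, assumption)+
qed

lemma bottom_0: "bottom 0 \<in> U \<and> u (Togo n) (bottom 0) \<and> u Start (bottom 0)"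
  unfolding bottom.simps by (rule someI_ex) (rule start[unfolded Bex_def])

lemma bottom: "bottom i \<in> U \<and> u Bottom (bottom i) \<and> u (Row 0) (bottom i) \<and> u (Col i) (bottom i)"
proof (induction i)
  case 0
  then show ?case using bottom_0 startD by blast
next
  case (Suc i)
  then show ?case using right[of "bottom i" i] by simp
qed

lemma bottom_Rt: "e Rt (bottom i) (bottom (Suc i))"
  and bottom_T: "e (T (if even i then 1 else 0)) (bottom i) (bottom (Suc i))"
  using right[of "bottom i" i] bottom[of i] by simp_all

lemma Togo_bottom: "i \<le> n \<Longrightarrow> u (Togo (n - i)) (bottom i)"
proof (induction i)
  case 0
  then show ?case using bottom_0 by simp
next
  case (Suc i)
  then have "u (Togo (Suc (n - Suc i))) (bottom i)" by (simp add: Suc_diff_Suc)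
  moreover have "counting M (n - Suc i)" using Suc.prems by (intro counts) simp
  ultimately show ?case
    using bottom[of i] bottom[of "Suc i"] bottom_Rt[of i] unfolding counting_def by blast
qed

text \<open>Up to column \<open>n\<close> the countdown supplies the marks; in column
  \<open>n\<close> it has reached \<open>Togo 0\<close>; from there the absence of a mark spreads to
  the right.\<close>

lemma Below_0_bottom: "u (Below 0) (bottom i) \<longleftrightarrow> i < n"
proof
  assume "i < n"
  then have "u (Togo (Suc (n - Suc i))) (bottom i)"
    using Togo_bottom[of i] by (simp add: Suc_diff_Suc)
  moreover have "counting M (n - Suc i)" using \<open>i < n\<close> by (intro counts) simp
  ultimately show "u (Below 0) (bottom i)"
    using bottom[of i] unfolding counting_def by blast
next
  have "\<not> u (Below 0) (bottom i)" if "n \<le> i"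
    using that
  proof (induction rule: dec_induct)
    case base
    then show ?case using Togo_0[of "bottom n"] Togo_bottom[of n] bottom[of n] by simp
  next
    case (step i)
    have "hold1 M (bottom (Suc i)) (neg (Below 0))"
      by (rule horizontalD[of "neg (Below 0)" _ 0 "bottom i"])
        (use bottom[of i] bottom[of "Suc i"] bottom_Rt[of i] step.IH in \<open>auto simp: horizontal_def\<close>)
    then show ?case by simp
  qed
  then show "u (Below 0) (bottom i) \<Longrightarrow> i < n" by (meson not_le)
qed

section \<open>Induction on rows: configurations and squares\<close>

definition level :: "nat \<Rightarrow> bool" where
  "level j \<longleftrightarrow> (\<forall>i. cell i j \<in> U \<and> u (Col i) (cell i j) \<and> u (Row j) (cell i j) \<and>
     u (At (fst (conf j))) (cell i j) \<and> (\<forall>r\<le>K. u (Below r) (cell i j) \<longleftrightarrow> i < reg r j) \<and>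
     (i = 0 \<longrightarrow> u First (cell i j)))"

text \<open>Above the bottom row all horizontal edges start in even columns, so for odd
  \<open>i\<close> the edge points left. The bottom row is generated from left to right, which makes
  its edges with odd \<open>i\<close> exceptional: they point right and belong to
  \<open>T 0\<close>.\<close>

definition linked :: "nat \<Rightarrow> bool" where
  "linked j \<longleftrightarrow> (\<forall>i. if even i
     then e (T (Suc j)) (cell i j) (cell (Suc i) j) \<and> e Rt (cell i j) (cell (Suc i) j)
     else if j = 0 then e (T 0) (cell i j) (cell (Suc i) j) \<and> e Rt (cell i j) (cell (Suc i) j)
     else e (T (Suc j)) (cell (Suc i) j) (cell i j) \<and> e Lf (cell (Suc i) j) (cell i j))"

lemma level_0: "level 0"
proof -
  have "u (Below r) (bottom i) \<longleftrightarrow> i < reg r 0" if "r \<le> K" for i r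
  proof (cases "r = 0")
    case True
    then show ?thesis
      using K Below_0_bottom by (simp add: reg_def conf_def run_0 input_def)
  next
    case False
    then have "reg r 0 = 0" by (simp add: reg_def conf_def run_0 input_def)
    then show ?thesis using bottom_Below[of "bottom i" r] False that bottom[of i] by simp
  qed
  then show ?thesis
    using bottom bottom_At bottom_0 startD
    by (auto simp: level_def cell_def conf_def run_0)
qed

lemma linked_0: "linked 0"
  using bottom_Rt bottom_T by (auto simp: linked_def cell_def split: if_splits) (metis One_nat_def)+

lemma adjacent: "linked j \<Longrightarrow> e Rt (cell i j) (cell (Suc i) j) \<or> e Lf (cell (Suc i) j) (cell i j)"
  unfolding linked_def by metis

lemma level_horizontal:
  assumes "level j" "linked j" "(c, d) \<in> set (horizontal r)" "r \<le> K" "hold1 M (cell i j) c"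
  shows "hold1 M (cell (Suc i) j) d"
  using assms horizontalD[OF assms(3,4), of "cell i j" "cell (Suc i) j"] adjacent[of j i]
  unfolding level_def by blast

text \<open>In column 0 the constraints on \<open>First\<close> fix \<open>BelowL\<close> and
  \<open>IsZero\<close>; the constraints on neighbours carry the bits along the row.\<close>

lemma level_bits:
  assumes "level j" "linked j" "r \<le> K"
  shows "u (BelowL r) (cell i j) \<longleftrightarrow> i < Suc (reg r j)"
    and "u (BelowR r) (cell i j) \<longleftrightarrow> Suc i < reg r j"
    and "u (IsZero r) (cell i j) \<longleftrightarrow> reg r j = 0"
proof -
  note H = level_horizontal[OF assms(1,2) _ assms(3)]
  have B: "u (Below r) (cell i j) \<longleftrightarrow> i < reg r j" for i
    using assms(1,3) unfolding level_def by blast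
  have F: "cell 0 j \<in> U" "u First (cell 0 j)" using assms(1) unfolding level_def by blast+
  show "u (BelowL r) (cell i j) \<longleftrightarrow> i < Suc (reg r j)"
  proof (cases i)
    case 0
    then show ?thesis using FirstD(1)[OF F(1) assms(3) F(2)] by simp
  next
    case (Suc k)
    then show ?thesis
      using H[of "pos (Below r)" "pos (BelowL r)" k] H[of "neg (Below r)" "neg (BelowL r)" k] B[of k]
      by (auto simp: horizontal_def)
  qed
  show "u (BelowR r) (cell i j) \<longleftrightarrow> Suc i < reg r j"
    using H[of "pos (BelowR r)" "pos (Below r)" i] H[of "neg (BelowR r)" "neg (Below r)" i]
      B[of "Suc i"]
    by (auto simp: horizontal_def)
  show "u (IsZero r) (cell i j) \<longleftrightarrow> reg r j = 0"
  proof (induction i)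
    case 0
    then show ?case using FirstD(2)[OF F(1) assms(3) F(2)] B[of 0] by simp
  next
    case (Suc i)
    then show ?case
      using H[of "pos (IsZero r)" "pos (IsZero r)" i] H[of "neg (IsZero r)" "neg (IsZero r)" i]
      by (auto simp: horizontal_def)
  qed
qed

text \<open>As the machine never halts, the state of row \<open>j\<close> is the address of an
  instruction, and \<open>up_con\<close> applies at every point of the row.\<close>

lemma level_up:
  assumes "level j"
  shows "cell i (Suc j) \<in> U" "e Up (cell i j) (cell i (Suc j))"
    "e (T (if even i then j else Suc j)) (cell i j) (cell i (Suc j))"
    "u (Row (Suc j)) (cell i (Suc j))" "u (Col i) (cell i (Suc j))"
  using up[of "cell i j" j "i mod 4" "fst (conf j)"] assms running[of j]
  by (simp_all add: level_def cell_def even_mod_4 conf_def)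

lemma level_Suc:
  assumes "level j" "linked j"
  shows "level (Suc j)"
  unfolding level_def
proof (intro allI conjI impI)
  fix i r
  let ?q = "fst (conf j)"
  have x: "cell i j \<in> U" "u (At ?q) (cell i j)" using assms(1) by (auto simp: level_def)
  have q: "?q < length P" using running by (simp add: conf_def)
  have conf: "conf (Suc j) = step (P ! ?q) (conf j)"
    using q by (simp add: conf_def run_Suc next_conf_def)
  show "cell i (Suc j) \<in> U" "u (Row (Suc j)) (cell i (Suc j))" "u (Col i) (cell i (Suc j))"
    using level_up[OF assms(1)] by blast+
  have Z: "u (IsZero r) (cell i j) \<longleftrightarrow> snd (conf j) r = 0" if "r < K" for r
    using level_bits(3)[OF assms, of r] that by (simp add: reg_def)
  show "u (At (fst (conf (Suc j)))) (cell i (Suc j))"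
    using At_up[OF x(1) level_up(1,2)[OF assms(1)] x(2) q Z] by (simp add: conf)
  show "u First (cell i (Suc j))" if "i = 0"
    using First_up[OF x(1) level_up(1)[OF assms(1)] _ level_up(2)[OF assms(1)]] assms(1) that
    by (simp add: level_def)
  assume r: "r \<le> K"
  have up: "u (Below r) (cell i (Suc j)) \<longleftrightarrow>
      u (if r = K then BelowL r else source (P ! ?q) r) (cell i j)"
    by (rule Below_up[OF x(1) level_up(1,2)[OF assms(1)] x(2) q r])
  have B: "u (Below r) (cell i j) \<longleftrightarrow> i < reg r j" using assms(1) r unfolding level_def by blast
  show "u (Below r) (cell i (Suc j)) \<longleftrightarrow> i < reg r (Suc j)"
  proof (cases "r = K")
    case True
    then show ?thesis using up level_bits(1)[OF assms r] by (simp add: reg_def)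
  next
    case False
    obtain p s where s: "conf j = (p, s)" by force
    show ?thesis
      using False up level_bits[OF assms r, of i] B
      by (cases "P ! p") (auto simp: reg_def conf s)
  qed
qed

lemma linked_Suc:
  assumes "level j" "linked j"
  shows "linked (Suc j)"
  unfolding linked_def
proof
  fix i
  have lv: "cell i j \<in> U" "u (Col i) (cell i j)" "u (Row j) (cell i j)" for i
    using assms(1) unfolding level_def by blast+
  note lu = level_up[OF assms(1)]
  show "if even i
     then e (T (Suc (Suc j))) (cell i (Suc j)) (cell (Suc i) (Suc j)) \<and> e Rt (cell i (Suc j)) (cell (Suc i) (Suc j))
     else if Suc j = 0 then e (T 0) (cell i (Suc j)) (cell (Suc i) (Suc j)) \<and> e Rt (cell i (Suc j)) (cell (Suc i) (Suc j))
     else e (T (Suc (Suc j))) (cell (Suc i) (Suc j)) (cell i (Suc j)) \<and> e Lf (cell (Suc i) (Suc j)) (cell i (Suc j))"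
  proof (cases "even i")
    case True
    let ?x = "cell i j" and ?y = "cell (Suc i) j" and ?z = "cell i (Suc j)" and ?w = "cell (Suc i) (Suc j)"
    have "e (T (Suc j)) ?x ?y" using assms(2) True unfolding linked_def by presburger
    moreover have "e (T (Suc j)) ?y ?w" using lu(3)[of "Suc i"] True by simp
    ultimately have "e (T (Suc j)) ?x ?w" using T_trans lv lu(1) by blast
    then have "\<not> e (T j) ?x ?w"
      using colours_disjoint[OF lv(1) lu(1) lv(3,2) True lu(4,5)] True by simp
    moreover have "e (T j) ?x ?z" using lu(3)[of i] True by simp
    \<comment> \<open>\<open>T (Suc j + 2)\<close> is \<open>T j\<close>. Were it to hold from
      \<open>?z\<close> to \<open>?w\<close>, the upward edge from \<open>?x\<close> to
      \<open>?z\<close> would put the diagonal into \<open>T j\<close>.\<close>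
    ultimately have "\<not> e (T (Suc j + 2)) ?z ?w"
      using T_trans[of j ?x ?z ?w] lv lu(1) by auto
    then show ?thesis
      using colours_cover[of ?z ?w "Suc j" i 1 Rt] lu[of i] lu[of "Suc i"] True by simp
  next
    case odd: False
    show ?thesis
    proof (cases "j = 0")
      case True
      \<comment> \<open>\<open>T 0\<close> leads from \<open>?x\<close> through \<open>?y\<close> to
        \<open>?w\<close>. It does not lead from \<open>?x\<close> to \<open>?z\<close>, so it
        cannot lead from \<open>?w\<close> to \<open>?z\<close>.\<close>
      let ?x = "cell i 0" and ?y = "cell (Suc i) 0" and ?z = "cell i 1" and ?w = "cell (Suc i) 1"
      have "e (T 0) ?x ?y" using assms(2) odd True unfolding linked_def by metis
      moreover have "e (T 0) ?y ?w" using lu(3)[of "Suc i"] odd True by simp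
      ultimately have "e (T 0) ?x ?w" using T_trans lv lu(1) True by (metis One_nat_def)
      moreover have "e (T 1) ?x ?z" using lu(3)[of i] odd True by simp
      then have "\<not> e (T 0) ?x ?z"
        using colours_bottom[of ?x ?z i] lv[of i] lu[of i] odd True by simp
      ultimately have "\<not> e (T (1 + 2)) ?w ?z"
        using T_trans[of 0 ?x ?w ?z] lv lu(1) True by (auto simp: numeral_3_eq_3)
      then show ?thesis
        using colours_cover[of ?w ?z 1 "Suc i" 3 Lf] lu[of i] lu[of "Suc i"] odd True
        by (simp add: numeral_3_eq_3)
    next
      case False
      \<comment> \<open>Mirror image of the even case: the even column is now the right one of the
        two.\<close>
      let ?x = "cell (Suc i) j" and ?y = "cell i j" and ?z = "cell (Suc i) (Suc j)" and ?w = "cell i (Suc j)"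
      have ev: "even (Suc i)" using odd by simp
      have "e (T (Suc j)) ?x ?y" using assms(2) odd False unfolding linked_def by presburger
      moreover have "e (T (Suc j)) ?y ?w" using lu(3)[of i] odd by simp
      ultimately have "e (T (Suc j)) ?x ?w" using T_trans lv lu(1) by blast
      then have "\<not> e (T j) ?x ?w"
        using colours_disjoint[OF lv(1) lu(1) lv(3,2) ev lu(4,5)] odd by simp
      moreover have "e (T j) ?x ?z" using lu(3)[of "Suc i"] odd by simp
      ultimately have "\<not> e (T (Suc j + 2)) ?z ?w"
        using T_trans[of j ?x ?z ?w] lv lu(1) by auto
      then show ?thesis
        using colours_cover[of ?z ?w "Suc j" "Suc i" 3 Lf] lu[of i] lu[of "Suc i"] odd
        by (simp add: numeral_3_eq_3)
    qed
  qed
qed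

lemma level_linked: "level j \<and> linked j"
  by (induction j) (auto simp: level_0 linked_0 level_Suc linked_Suc)

text \<open>Two equal rows would show different times on the clock.\<close>

lemma contradiction: False
proof -
  \<comment> \<open>\<open>R t\<close> records row \<open>t\<close> as a function on the finite set
    of column types with bottom points, so two rows must agree.\<close>
  define D where "D = range (\<lambda>i. (i mod 4, bottom i))"
  define R where "R t = restrict (\<lambda>(c, x). column c x t) D" for t
  have cell: "cell i t \<in> U" for i t
    using level_linked[of t] unfolding level_def by blast
  have "D \<subseteq> {..<4} \<times> U" using bottom by (auto simp: D_def)
  moreover have "Finite_Set.finite ({..<4::nat} \<times> U)" using finite by simp
  ultimately have "Finite_Set.finite D" by (rule finite_subset)
  then have "Finite_Set.finite (D \<rightarrow>\<^sub>E U)" using finite by (intro finite_PiE) simp_all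
  moreover have "R t \<in> D \<rightarrow>\<^sub>E U" for t
    using cell unfolding R_def restrict_PiE_iff by (auto simp: D_def cell_def)
  then have "range R \<subseteq> D \<rightarrow>\<^sub>E U" by blast
  ultimately have "Finite_Set.finite (range R)" by (rule rev_finite_subset)
  then have "\<not> inj R" using finite_imageD infinite_UNIV_nat by blast
  then obtain s t where st: "s < t" "R s = R t"
    unfolding inj_on_def by (metis UNIV_I linorder_neqE_nat)
  \<comment> \<open>Column \<open>s\<close> tells the two rows apart: the clock mark there is absent
    in row \<open>s\<close> and present in every later row.\<close>
  have "(s mod 4, bottom s) \<in> D" by (simp add: D_def)
  then have "R t' (s mod 4, bottom s) = cell s t'" for t' by (simp add: R_def cell_def)
  with st(2) have "cell s s = cell s t" by metis
  moreover have "u (Below K) (cell s j) \<longleftrightarrow> s < j" for j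
    using level_linked[of j] unfolding level_def by (simp add: reg_def)
  ultimately show False using st(1) by (metis less_irrefl)
qed

end

lemma finite_model_imp_halts:
  assumes "finite_model_3T M (Conj (machine_fm P K) (input_fm n))"
    and "\<And>I. I \<in> set P \<Longrightarrow> register I < K" "0 < K"
  shows "halts P (0, input n)"
proof (rule ccontr)
  assume "\<not> halts P (0, input n)"
  then have run: "fst (run P (0, input n) t) < length P" for t by (simp add: halts_def not_le)
  have M: "finite (universe M)" "universe M \<noteq> {}" "transitive_in M T1" "transitive_in M T2"
    "transitive_in M T3" and mod: "models M (Conj (machine_fm P K) (input_fm n))"
    using assms(1) unfolding finite_model_3T_def by blast+
  obtain x where "x \<in> universe M" using M(2) by blast
  then have "range (\<lambda>_::nat. x) \<subseteq> universe M" by blast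
  with mod have sat: "sat M (\<lambda>_. x) (machine_fm P K)" "sat M (\<lambda>_. x) (input_fm n)"
    unfolding models_def sat.simps by blast+
  have "transitive_in M (T k)" for k
  proof -
    have "k mod 3 = 0 \<or> k mod 3 = 1 \<or> k mod 3 = 2" by linarith
    then show ?thesis using M(3-5) unfolding T_def by (elim disjE) simp_all
  qed
  moreover have "holds M c" if "c \<in> set (machine_cons P K)" for c
    using sat(1) that unfolding sat_machine_fm by blast
  moreover have "counting M i" if "i < n" for i using sat(2) that unfolding sat_input_fm by blast
  moreover have "\<exists>x\<in>universe M. interp M (Togo n) [x] \<and> interp M Start [x]"
    using sat(2) unfolding sat_input_fm by blast
  ultimately have "machine_model M P K n"
    using M(1) assms(2,3) run by (intro machine_model.intro) assumption+
  then show False by (rule machine_model.contradiction)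
qed

section \<open>A finite model for a halting machine\<close>

text \<open>The columns end in a cycle of length 4, which preserves the column types.\<close>

definition nxt :: "nat \<Rightarrow> nat \<Rightarrow> nat" where
  "nxt X i = (if i = X then X - 3 else Suc i)"

definition adj :: "nat \<Rightarrow> nat \<Rightarrow> nat \<Rightarrow> bool" where
  "adj X i i' \<longleftrightarrow> i' = nxt X i \<or> i = nxt X i'"

text \<open>The four groups are: the closure of the horizontal edges in rows \<open>k - 1\<close> and the upward edges
  in odd columns; the upward edges in even columns followed by the edges of the third group; the
  edges between columns of different parity that are not adjacent; the edges that
  generate the bottom row, followed by edges of the second and third group.\<close>

definition edge :: "nat \<Rightarrow> nat \<Rightarrow> nat \<times> nat \<Rightarrow> nat \<times> nat \<Rightarrow> bool" where
  "edge X k = (\<lambda>(i, j) (i', j').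
     j mod 3 = (k + 2) mod 3 \<and>
       (even i \<and> odd i' \<and> adj X i i' \<and> (j' = j \<or> j' = Suc j) \<or> odd i \<and> i' = i \<and> j' = Suc j) \<or>
     j mod 3 = k mod 3 \<and> even i \<and>
       (i' = i \<and> j' = Suc j \<or>
        odd i' \<and> j' mod 3 = Suc k mod 3 \<and> \<not> (j' = Suc j \<and> adj X i i')) \<or>
     j mod 3 = Suc k mod 3 \<and> even i \<and> odd i' \<and> j' mod 3 = Suc k mod 3 \<and> \<not> (j' = j \<and> adj X i i') \<or>
     k mod 3 = 0 \<and> j = 0 \<and> odd i \<and>
       (i' = nxt X i \<and> (j' = 0 \<or> j' = 1) \<or>
        odd i' \<and> j' mod 3 = 1 \<and> \<not> (j' = 1 \<and> adj X (nxt X i) i')))"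

lemma
  assumes "X mod 4 = 3"
  shows even_nxt: "even (nxt X i) \<longleftrightarrow> odd i"
    and nxt_mod_4: "nxt X i mod 4 = Suc i mod 4"
    and nxt_le: "i \<le> X \<Longrightarrow> nxt X i \<le> X"
proof -
  obtain m where X: "X = 4 * m + 3" using assms by (metis mult_div_mod_eq)
  have "Suc X = 4 * (m + 1)" using X by simp
  then have "Suc X mod 4 = 0" by (simp only: mod_mult_self1_is_0)
  then show "nxt X i mod 4 = Suc i mod 4" using X by (auto simp: nxt_def)
  show "even (nxt X i) \<longleftrightarrow> odd i" using X by (auto simp: nxt_def)
  show "i \<le> X \<Longrightarrow> nxt X i \<le> X" by (auto simp: nxt_def)
qed

text \<open>Few edges compose. From odd columns, no edge leaves the rows congruent to
  \<open>k + 1\<close>, only upward edges leave those congruent to \<open>k + 2\<close>, and among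
  those congruent to \<open>k\<close> only row 0 has any. The compositions that do arise are listed
  in the definition.\<close>

lemma edge_trans:
  assumes "X mod 4 = 3" "edge X k x y" "edge X k y z"
  shows "edge X k x z"
proof -
  obtain i j where x: "x = (i, j)" by force
  obtain i' j' where y: "y = (i', j')" by force
  obtain i'' j'' where z: "z = (i'', j'')" by force
  \<comment> \<open>Row classes relative to \<open>k\<close>: \<open>A\<close> lies just below,
    \<open>B\<close> at \<open>k\<close>, and \<open>C\<close> just above, modulo 3.\<close>
  define A B C where "A = (k + 2) mod 3" and "B = k mod 3" and "C = Suc k mod 3"
  have neq: "A \<noteq> B" "B \<noteq> C" "A \<noteq> C" unfolding A_def B_def C_def by presburger+
  have "Suc (A) mod 3 = (k + 3) mod 3" unfolding A_def by (simp only: mod_Suc_eq) simp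
  then have A: "Suc A mod 3 = B" by (simp add: B_def)
  have AB: "Suc j mod 3 = B" if "j mod 3 = A" for j using mod_Suc_eq[of j 3] A that by simp
  have BC: "Suc j mod 3 = C" if "j mod 3 = B" for j
    using mod_Suc_eq[of j 3] mod_Suc_eq[of k 3] that unfolding B_def C_def by simp
  have C1: "C = 1" if "B = 0" using BC[of 0] that by simp
  have par: "even (nxt X i) \<longleftrightarrow> odd i" for i using even_nxt[OF assms(1)] .
  have E: "edge X k (i, j) (i', j') \<longleftrightarrow>
     j mod 3 = A \<and>
       (even i \<and> odd i' \<and> adj X i i' \<and> (j' = j \<or> j' = Suc j) \<or> odd i \<and> i' = i \<and> j' = Suc j) \<or>
     j mod 3 = B \<and> even i \<and>
       (i' = i \<and> j' = Suc j \<or> odd i' \<and> j' mod 3 = C \<and> \<not> (j' = Suc j \<and> adj X i i')) \<or>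
     j mod 3 = C \<and> even i \<and> odd i' \<and> j' mod 3 = C \<and> \<not> (j' = j \<and> adj X i i') \<or>
     B = 0 \<and> j = 0 \<and> odd i \<and>
       (i' = nxt X i \<and> (j' = 0 \<or> j' = 1) \<or>
        odd i' \<and> j' mod 3 = 1 \<and> \<not> (j' = 1 \<and> adj X (nxt X i) i'))" for i j i' j'
    by (simp only: edge_def prod.case A_def B_def C_def)
  have oddA: "i'' = i' \<and> j'' = Suc j'" if "odd i'" "j' mod 3 = A"
    using assms(3) that neq unfolding y z E by (elim disjE conjE) auto
  have oddB: "j' = 0" if "odd i'" "j' mod 3 = B"
    using assms(3) that neq unfolding y z E by (elim disjE conjE) auto
  have oddC: False if "odd i'" "j' mod 3 = C"
    using assms(3) that neq unfolding y z E by (elim disjE conjE) auto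
  have evenB: "i'' = i' \<and> j'' = Suc j' \<or> odd i'' \<and> j'' mod 3 = C \<and> \<not> (j'' = Suc j' \<and> adj X i' i'')"
    if "even i'" "j' mod 3 = B"
    using assms(3) that neq unfolding y z E by (elim disjE conjE) auto
  have evenC: "odd i'' \<and> j'' mod 3 = C \<and> \<not> (j'' = j' \<and> adj X i' i'')"
    if "even i'" "j' mod 3 = C"
    using assms(3) that neq unfolding y z E by (elim disjE conjE) auto
  from assms(2)[unfolded x y E] consider
      (a) "j mod 3 = A" "even i" "odd i'" "adj X i i'" "j' = j"
    | (b) "j mod 3 = A" "odd i'" "j' = Suc j"
    | (d) "j mod 3 = B" "even i" "i' = i" "j' = Suc j"
    | (e) "odd i'" "j' mod 3 = C"
    | (g) "B = 0" "j = 0" "odd i" "i' = nxt X i" "j' = 0"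
    | (h) "B = 0" "j = 0" "odd i" "i' = nxt X i" "j' = 1"
    using C1 by (elim disjE conjE) simp_all
  then show ?thesis
  proof cases
    case a
    then show ?thesis using oddA unfolding x z E by simp
  next
    case b
    \<comment> \<open>The middle point is in an odd column of class \<open>B\<close> but not in row
      0, so no edge leaves it.\<close>
    then show ?thesis using oddB AB by simp
  next
    case d
    then show ?thesis using evenC BC unfolding x z E by simp
  next
    case e
    then show ?thesis using oddC by blast
  next
    case g
    then have "even i'" using par by simp
    with g show ?thesis using evenB C1 unfolding x z E by auto
  next
    case h
    then have "even i'" using par by simp
    with h show ?thesis using evenC C1 unfolding x z E by auto
  qed
qed

lemma mod_Suc_cong: "a mod m = b mod m \<Longrightarrow> Suc a mod m = Suc b mod m"
  by (metis mod_Suc_eq)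

text \<open>With \<open>X mod 4 = 3\<close> the leap from column \<open>X\<close> back to
  \<open>X - 3\<close> respects column types. The 4 in the bound makes even the increased register
  values at most \<open>X - 3\<close>, so all marks are absent on the cycle and the leap does not
  disturb them.\<close>

locale halting_machine =
  fixes P :: "instr list" and K n X Y :: nat
  assumes registers: "I \<in> set P \<Longrightarrow> register I < K" and K: "0 < K"
    and halted: "length P \<le> fst (run P (0, input n) Y)"
    and running: "t < Y \<Longrightarrow> fst (run P (0, input n) t) < length P"
    and X: "X mod 4 = 3"
    and bound: "t \<le> Y \<Longrightarrow> r \<le> K \<Longrightarrow> (if r = K then t else snd (run P (0, input n) t) r) + 4 \<le> X"
begin

definition conf :: "nat \<Rightarrow> nat \<times> (nat \<Rightarrow> nat)" where
  "conf t = run P (0, input n) t"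

definition reg :: "nat \<Rightarrow> nat \<Rightarrow> nat" where
  "reg r t = (if r = K then t else snd (conf t) r)"

definition unary_val :: "nat \<Rightarrow> nat \<Rightarrow> nat \<times> nat \<Rightarrow> bool" where
  "unary_val t a = (\<lambda>(i, j).
     if t = 0 then a = j mod 3
     else if t = 1 then a = i mod 4
     else if t = 2 then (if a = 0 then i = 0 \<and> j = 0 else if a = 1 then j = 0 else i = 0)
     else if t = 3 then a = fst (conf j)
     else if t = 4 then i < reg a j
     else if t = 5 then i < Suc (reg a j)
     else if t = 6 then Suc i < reg a j
     else if t = 7 then reg a j = 0
     else j = 0 \<and> i + a = n)"

definition binary_val :: "nat \<Rightarrow> nat \<times> nat \<Rightarrow> nat \<times> nat \<Rightarrow> bool" where
  "binary_val a = (\<lambda>(i, j) (i', j').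
     if a = 0 then i' = nxt X i \<and> j' = j
     else if a = 1 then i = nxt X i' \<and> j' = j
     else i' = i \<and> j' = Suc j)"

definition val :: "psym \<Rightarrow> (nat \<times> nat) list \<Rightarrow> bool" where
  "val p xs = (case p of
       T1 \<Rightarrow> edge X 0 (xs ! 0) (xs ! 1)
     | T2 \<Rightarrow> edge X 1 (xs ! 0) (xs ! 1)
     | T3 \<Rightarrow> edge X 2 (xs ! 0) (xs ! 1)
     | Pred m a \<Rightarrow> if m = 1 then unary_val (fst (prod_decode a)) (snd (prod_decode a)) (xs ! 0)
         else binary_val a (xs ! 0) (xs ! 1))"

definition G :: "(nat \<times> nat) struct" where
  "G = \<lparr>universe = {..X} \<times> {..Y}, interp = val\<rparr>"

lemma universe_G: "universe G = {..X} \<times> {..Y}"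
  by (simp add: G_def)

lemma edge_mod: "edge X (k mod 3) = edge X k"
proof -
  have "(k mod 3 + 2) mod 3 = (k + 2) mod 3" "Suc (k mod 3) mod 3 = Suc k mod 3"
    by (simp_all only: mod_Suc_eq mod_add_left_eq)
  then show ?thesis by (simp add: edge_def)
qed

lemma interp_T: "interp G (T k) [x, y] \<longleftrightarrow> edge X k x y"
proof -
  have "k mod 3 = 0 \<or> k mod 3 = 1 \<or> k mod 3 = 2" by linarith
  moreover have "interp G (T k) [x, y] \<longleftrightarrow> edge X (k mod 3) x y"
    using calculation by (elim disjE) (simp_all add: T_def G_def val_def)
  ultimately show ?thesis by (simp only: edge_mod)
qed

lemma interp_unary:
  "interp G (Row k) [(i, j)] \<longleftrightarrow> k mod 3 = j mod 3"
  "interp G (Col k) [(i, j)] \<longleftrightarrow> k mod 4 = i mod 4"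
  "interp G Start [(i, j)] \<longleftrightarrow> i = 0 \<and> j = 0"
  "interp G Bottom [(i, j)] \<longleftrightarrow> j = 0"
  "interp G First [(i, j)] \<longleftrightarrow> i = 0"
  "interp G (At k) [(i, j)] \<longleftrightarrow> k = fst (conf j)"
  "interp G (Below k) [(i, j)] \<longleftrightarrow> i < reg k j"
  "interp G (BelowL k) [(i, j)] \<longleftrightarrow> i < Suc (reg k j)"
  "interp G (BelowR k) [(i, j)] \<longleftrightarrow> Suc i < reg k j"
  "interp G (IsZero k) [(i, j)] \<longleftrightarrow> reg k j = 0"
  "interp G (Togo k) [(i, j)] \<longleftrightarrow> j = 0 \<and> i + k = n"
  by (simp_all add: G_def val_def psym_defs unary_val_def)

lemma interp_binary:
  "interp G Rt [(i, j), (i', j')] \<longleftrightarrow> i' = nxt X i \<and> j' = j"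
  "interp G Lf [(i, j), (i', j')] \<longleftrightarrow> i = nxt X i' \<and> j' = j"
  "interp G Up [(i, j), (i', j')] \<longleftrightarrow> i' = i \<and> j' = Suc j"
  by (simp_all add: G_def val_def psym_defs binary_val_def)

lemmas interp_G = interp_T interp_unary interp_binary

lemma args_simps:
  "args (T k) x y = [x, y]" "args Rt x y = [x, y]" "args Lf x y = [x, y]" "args Up x y = [x, y]"
  "args (Row k) x y = [y]" "args (Col k) x y = [y]" "args Bottom x y = [y]" "args First x y = [y]"
  "args (At k) x y = [y]" "args (Below k) x y = [y]"
  by (simp_all add: args_def)

lemma holds_AU:
  assumes "\<And>i j. i \<le> X \<Longrightarrow> j \<le> Y \<Longrightarrow> list_all (hold1 G (i, j)) ls \<Longrightarrow> list_all (hold1 G (i, j)) ms"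
  shows "holds G (AU ls ms)"
  using assms by (auto simp: universe_G)

lemma holds_AA:
  assumes "\<And>i j i' j'. i \<le> X \<Longrightarrow> j \<le> Y \<Longrightarrow> i' \<le> X \<Longrightarrow> j' \<le> Y \<Longrightarrow>
    list_all (hold1 G (i, j)) ls \<Longrightarrow> list_ex (hold2 G (i, j) (i', j')) ms"
  shows "holds G (AA ls ms)"
  using assms by (auto simp: universe_G)

lemma holds_AE:
  assumes "\<And>i j. i \<le> X \<Longrightarrow> j \<le> Y \<Longrightarrow> list_all (hold1 G (i, j)) ls \<Longrightarrow>
    \<exists>i' j'. i' \<le> X \<and> j' \<le> Y \<and> list_all (hold2 G (i, j) (i', j')) ms"
  shows "holds G (AE ls ms)"
  unfolding holds.simps universe_G
proof (intro ballI impI)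
  fix x assume "x \<in> {..X} \<times> {..Y}" "list_all (hold1 G x) ls"
  moreover obtain i j where "x = (i, j)" by force
  ultimately obtain i' j' where "i' \<le> X" "j' \<le> Y" "list_all (hold2 G x (i', j')) ms"
    using assms[of i j] by auto
  then show "\<exists>y\<in>{..X} \<times> {..Y}. list_all (hold2 G x y) ms"
    by (intro bexI[of _ "(i', j')"]) auto
qed

section \<open>The grid constraints in the intended model\<close>

lemma edge_even_odd:
  assumes "even i" "odd i'"
  shows "edge X k (i, j) (i', j') \<longleftrightarrow>
    j mod 3 = (k + 2) mod 3 \<and> adj X i i' \<and> (j' = j \<or> j' = Suc j) \<or>
    j mod 3 = k mod 3 \<and> j' mod 3 = Suc k mod 3 \<and> \<not> (j' = Suc j \<and> adj X i i') \<or>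
    j mod 3 = Suc k mod 3 \<and> j' mod 3 = Suc k mod 3 \<and> \<not> (j' = j \<and> adj X i i')"
  using assms by (auto simp: edge_def)

lemma edge_cong: "k mod 3 = l mod 3 \<Longrightarrow> edge X k = edge X l"
  using edge_mod by metis

lemma holds_bottom: "holds G (bottom_con c)"
  unfolding bottom_con_def
proof (rule holds_AE)
  fix i j
  assume i: "i \<le> X" and "list_all (hold1 G (i, j)) [pos Bottom, pos (Col c)]"
  then have j: "j = 0" and c: "c mod 4 = i mod 4" by (simp_all add: interp_G)
  have "Suc c mod 4 = nxt X i mod 4"
    using mod_Suc_cong[OF c] nxt_mod_4[OF X, of i] by simp
  moreover have "even c \<longleftrightarrow> even i" using arg_cong[OF c, of even] by (simp add: even_mod_4)
  moreover have "edge X 1 (i, 0) (nxt X i, 0)" if "even i"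
    using that by (simp add: edge_def even_nxt[OF X] adj_def)
  moreover have "edge X 0 (i, 0) (nxt X i, 0)" if "odd i"
    using that by (simp add: edge_def)
  ultimately show "\<exists>i' j'. i' \<le> X \<and> j' \<le> Y \<and> list_all (hold2 G (i, j) (i', j'))
      [pos Rt, pos (T (if even c then 1 else 0)), pos Bottom, pos (Row 0), pos (Col (c + 1))]"
    using nxt_le[OF X i] j
    by (intro exI[of _ "nxt X i"] exI[of _ 0]) (simp add: args_simps interp_G)
qed

text \<open>A pair of these types in \<open>T (J + 1)\<close> joins adjacent columns in consecutive
  rows, and \<open>T J\<close> omits exactly such pairs.\<close>

lemma holds_disjoint:
  assumes "even c" "odd d"
  shows "holds G (disjoint_con j c d)"
  unfolding disjoint_con_def
proof (rule holds_AA)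
  fix i J i' J'
  assume "list_all (hold1 G (i, J)) [pos (Row j), pos (Col c)]"
  then have j: "j mod 3 = J mod 3" and c: "c mod 4 = i mod 4" by (simp_all add: interp_G)
  have i: "even i" using arg_cong[OF c, of even] assms(1) by (simp add: even_mod_4)
  have ej: "edge X j = edge X J" "edge X (Suc j) = edge X (Suc J)" "Suc j mod 3 = Suc J mod 3"
    using edge_cong[OF j] edge_cong[OF mod_Suc_cong[OF j]] mod_Suc_cong[OF j] by simp_all
  have m: "(Suc J + 2) mod 3 = J mod 3" "Suc J mod 3 \<noteq> J mod 3" "Suc (Suc J) mod 3 \<noteq> J mod 3"
    "(J + 2) mod 3 \<noteq> J mod 3" by presburger+
  show "list_ex (hold2 G (i, J) (i', J'))
      [neg (Row (j + 1)), neg (Col d), neg (T (j + 1)), neg (T j)]"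
  proof (rule ccontr)
    assume "\<not> ?thesis"
    then have *: "Suc J mod 3 = J' mod 3" "d mod 4 = i' mod 4"
      "edge X (Suc J) (i, J) (i', J')" "edge X J (i, J) (i', J')"
      by (simp_all add: args_simps interp_G ej)
    have i': "odd i'" using arg_cong[OF *(2), of even] assms(2) by (simp add: even_mod_4)
    show False using *(1,3,4) m unfolding edge_even_odd[OF i i'] by metis
  qed
qed

text \<open>\<open>T (J + 2)\<close> contains all pairs of these types except neighbours in the same
  row, and neighbours are in \<open>T (J + 1)\<close> by the first group of edges.\<close>

lemma holds_cover:
  assumes "even c" "d = 1 \<and> p \<in> {T (j + 1), Rt} \<or> d = 3 \<and> p \<in> {T (j + 1), Lf}"
  shows "holds G (cover_con j c d p)"
  unfolding cover_con_def
proof (rule holds_AA)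
  fix i J i' J'
  assume "list_all (hold1 G (i, J)) [pos (Row j), pos (Col c)]"
  then have j: "j mod 3 = J mod 3" and c: "c mod 4 = i mod 4" by (simp_all add: interp_G)
  have i: "even i" using arg_cong[OF c, of even] assms(1) by (simp add: even_mod_4)
  have ej: "edge X (Suc j) = edge X (Suc J)" "edge X (Suc (Suc j)) = edge X (Suc (Suc J))"
    using edge_cong[OF mod_Suc_cong[OF j]] edge_cong[OF mod_Suc_cong[OF mod_Suc_cong[OF j]]]
    by simp_all
  have "edge X (Suc J) (i, J) (i', J') \<and> (d = 1 \<longrightarrow> i' = nxt X i) \<and> (d = 3 \<longrightarrow> i = nxt X i') \<and> J' = J"
    if "J mod 3 = J' mod 3" "(c + d) mod 4 = i' mod 4" "\<not> edge X (Suc (Suc J)) (i, J) (i', J')"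
  proof -
    have m: "(Suc J + 2) mod 3 = J mod 3" "Suc (Suc (Suc J)) mod 3 = J mod 3" by presburger+
    have i': "(i + d) mod 4 = i' mod 4" using that(2) mod_add_cong[OF c refl, of d] by simp
    have odd: "odd i'" using arg_cong[OF i', of even] i assms(2) by (auto simp: even_mod_4)
    have "edge X (Suc (Suc J)) (i, J) (i', J')" if "\<not> (J' = J \<and> adj X i i')"
      unfolding edge_even_odd[OF i odd]
      by (intro disjI2 conjI that) (simp_all only: m(2) \<open>J mod 3 = J' mod 3\<close>)
    with that(3) have ad: "J' = J" "adj X i i'" by blast+
    \<comment> \<open>Otherwise \<open>i'\<close> would be the left neighbour, and the column types
      would differ by 2 modulo 4.\<close>
    moreover have "i' = nxt X i" if "d = 1"
    proof (rule ccontr)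
      assume "i' \<noteq> nxt X i"
      then have "i mod 4 = Suc i' mod 4" using ad(2) nxt_mod_4[OF X] unfolding adj_def by metis
      then have "i mod 4 = (i + 2) mod 4" using mod_Suc_cong[OF i'] that by simp
      then show False by presburger
    qed
    moreover have "i = nxt X i'" if "d = 3"
    proof (rule ccontr)
      assume "i \<noteq> nxt X i'"
      then have "i' mod 4 = Suc i mod 4" using ad(2) nxt_mod_4[OF X] unfolding adj_def by metis
      then have "(i + 3) mod 4 = Suc i mod 4" using i' that by simp
      then show False by presburger
    qed
    moreover have "edge X (Suc J) (i, J) (i', J')"
      unfolding edge_even_odd[OF i odd] using m(1) ad by simp
    ultimately show ?thesis using ad by blast
  qed
  note * = this
  show "list_ex (hold2 G (i, J) (i', J'))
      [neg (Row j), neg (Col (c + d)), pos (T (j + 2)), pos p]"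
  proof (rule ccontr)
    assume "\<not> ?thesis"
    then have h: "J mod 3 = J' mod 3" "(c + d) mod 4 = i' mod 4" "\<not> edge X (Suc (Suc J)) (i, J) (i', J')"
      and np: "\<not> hold2 G (i, J) (i', J') (pos p)"
      using j by (simp_all add: args_simps interp_G ej)
    from assms(2) consider "p = T (j + 1)" | "d = 1" "p = Rt" | "d = 3" "p = Lf" by blast
    then have "hold2 G (i, J) (i', J') (pos p)"
    proof cases
      case 1
      have "edge X (Suc J) (i, J) (i', J')" using *[OF h] by blast
      then show ?thesis unfolding 1 by (simp add: args_simps interp_G ej)
    next
      case 2
      have "i' = nxt X i" "J' = J" using *[OF h] 2 by blast+
      then show ?thesis unfolding 2 by (simp add: args_simps interp_G)
    next
      case 3
      have "i = nxt X i'" "J' = J" using *[OF h] 3 by blast+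
      then show ?thesis unfolding 3 hold2.simps args_simps interp_G by blast
    qed
    with np show False by contradiction
  qed
qed

text \<open>From an odd column in these rows, \<open>T 1\<close> contains only the upward edge.
  \<open>T 0\<close> omits it in row 0, since \<open>i\<close> is adjacent to
  \<open>nxt X i\<close>; in the other rows no edge of \<open>T 0\<close> leaves the point.\<close>

lemma holds_bottom_disjoint:
  assumes "odd c"
  shows "holds G (bottom_disjoint_con c)"
  unfolding bottom_disjoint_con_def
proof (rule holds_AA)
  fix i J i' J'
  assume "list_all (hold1 G (i, J)) [pos (Row 0), pos (Col c)]"
  then have j: "J mod 3 = 0" and c: "c mod 4 = i mod 4" by (simp_all add: interp_G)
  have i: "odd i" using arg_cong[OF c, of even] assms by (simp add: even_mod_4)
  show "list_ex (hold2 G (i, J) (i', J')) [neg (Row 1), neg (Col c), neg (T 1), neg (T 0)]"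
  proof (rule ccontr)
    assume "\<not> ?thesis"
    then have "\<not> hold2 G (i, J) (i', J') (neg (Col c))" "\<not> hold2 G (i, J) (i', J') (neg (T 1))"
      "\<not> hold2 G (i, J) (i', J') (neg (T 0))" by (simp_all del: hold2.simps)
    then have *: "c mod 4 = i' mod 4" "edge X 1 (i, J) (i', J')" "edge X 0 (i, J) (i', J')"
      by (simp_all add: args_simps interp_G)
    have "odd i'" using arg_cong[OF *(1), of even] assms by (simp add: even_mod_4)
    moreover have "i' = i" "J' = Suc J" using *(2) i j by (auto simp: edge_def)
    moreover have "nxt X i \<noteq> i" using even_nxt[OF X, of i] by metis
    ultimately show False using i j *(3) by (auto simp: edge_def adj_def even_nxt[OF X])
  qed
qed

lemma holds_up:
  assumes "q < length P"
  shows "holds G (up_con q j c)"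
  unfolding up_con_def
proof (rule holds_AE)
  fix i J
  assume i: "i \<le> X" "J \<le> Y" and "list_all (hold1 G (i, J)) [pos (Row j), pos (Col c), pos (At q)]"
  then have j: "j mod 3 = J mod 3" and c: "c mod 4 = i mod 4" and q: "q = fst (conf J)"
    by (simp_all add: interp_G)
  \<comment> \<open>In row \<open>Y\<close> the machine has halted, so its state there is not the
    address of an instruction.\<close>
  have "J \<noteq> Y" using halted q assms by (auto simp: conf_def)
  then have J: "Suc J \<le> Y" using i(2) by simp
  have "even c \<longleftrightarrow> even i" using arg_cong[OF c, of even] by (simp add: even_mod_4)
  moreover have "Suc j mod 3 = Suc J mod 3" using j by (rule mod_Suc_cong)
  moreover have "edge X j (i, J) (i, Suc J)" if "even i" using that j by (simp add: edge_def)
  moreover have "edge X (Suc j) (i, J) (i, Suc J)" if "odd i"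
  proof -
    have "(Suc j + 2) mod 3 = J mod 3" using j by simp
    then show ?thesis using that by (simp add: edge_def)
  qed
  ultimately show "\<exists>i' j'. i' \<le> X \<and> j' \<le> Y \<and> list_all (hold2 G (i, J) (i', j'))
      [pos Up, pos (T (if even c then j else j + 1)), pos (Row (j + 1)), pos (Col c)]"
    using i J c by (intro exI[of _ i] exI[of _ "Suc J"]) (simp add: args_simps interp_G)
qed

section \<open>The machine constraints in the intended model\<close>

lemma conf_0: "conf 0 = (0, input n)"
  by (simp add: conf_def run_0)

lemma conf_Suc: "j < Y \<Longrightarrow> conf (Suc j) = step (P ! fst (conf j)) (conf j)"
  using running by (simp add: conf_def run_Suc next_conf_def)

lemma reg_bound: "j \<le> Y \<Longrightarrow> r \<le> K \<Longrightarrow> reg r j + 4 \<le> X"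
  using bound unfolding reg_def conf_def .

lemma reg_0: "reg 0 0 = n" "0 < r \<Longrightarrow> reg r 0 = 0"
  using K by (simp_all add: reg_def conf_0 input_def)

lemma holds_grid:
  assumes "c \<in> set grid_cons"
  shows "holds G c"
proof -
  have "list_all (holds G) grid_cons"
    unfolding grid_cons_def list_all_append list_all_concat list_all_map ball_set_map
    by (intro conjI ballI holds_bottom holds_disjoint holds_cover holds_bottom_disjoint) auto
  then show ?thesis using assms by (simp add: list_all_iff)
qed

lemma holds_start: "list_all (holds G) (start_cons K)"
proof -
  have "holds G (AU [pos Start] [pos Bottom, pos (Row 0), pos (Col 0), pos First])"
    by (rule holds_AU) (simp add: interp_G)
  moreover have "holds G (AA [pos First] [neg Up, pos First])"
    by (rule holds_AA) (auto simp: interp_G args_simps)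
  moreover have "holds G (AU [pos Bottom] (pos (At 0) # [neg (Below r). r \<leftarrow> [1..<Suc K]]))"
    by (rule holds_AU) (auto simp: interp_G list_all_iff conf_0 reg_0 simp del: upt_Suc)
  moreover have "holds G (AU [pos (Togo 0)] [neg (Below 0)])"
    by (rule holds_AU) (simp add: interp_G reg_0)
  ultimately show ?thesis by (simp only: start_cons_def list.pred_inject simp_thms)
qed

text \<open>Only the leap from column \<open>X\<close> back to \<open>X - 3\<close> needs care, and
  by \<open>reg_bound\<close> no marks occur on that cycle.\<close>

lemma hold1_horizontal:
  assumes "(c, d) \<in> set (horizontal r)" "r \<le> K" "j \<le> Y" "hold1 G (i, j) c"
  shows "hold1 G (nxt X i, j) d"
proof -
  have "reg r j + 4 \<le> X" using assms reg_bound by simp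
  then show ?thesis
    using assms(1,4) by (auto simp: horizontal_def interp_G nxt_def split: if_splits)
qed

lemma holds_bits:
  assumes "r \<le> K"
  shows "list_all (holds G) (bit_cons r)"
proof -
  have "holds G (AA [c] [neg Rt, d])" "holds G (AA [negate d] [neg Lf, negate c])"
    if cd: "(c, d) \<in> set (horizontal r)" for c d
  proof -
    obtain b p b' p' where [simp]: "c = (b, p)" "d = (b', p')" by force
    have a: "args p x y = [y]" "args p' x y = [y]" for x y :: "nat \<times> nat"
      using arity_horizontal[OF cd] by (simp_all add: args_def)
    have h: "interp G p' [(nxt X i, j)] = b'" if "interp G p [(i, j)] = b" "j \<le> Y" for i j
      using hold1_horizontal[OF cd assms that(2), of i] that(1) by simp
    show "holds G (AA [c] [neg Rt, d])"
      by (rule holds_AA) (use h in \<open>auto simp: args_simps a interp_binary\<close>)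
    show "holds G (AA [negate d] [neg Lf, negate c])"
      by (rule holds_AA) (use h in \<open>auto simp: args_simps a interp_binary\<close>)
  qed
  moreover have "holds G (AU [pos First] [pos (BelowL r)])"
    "holds G (AU [pos First, pos (Below r)] [neg (IsZero r)])"
    "holds G (AU [pos First, neg (Below r)] [pos (IsZero r)])"
    by (rule holds_AU, simp add: interp_G)+
  ultimately show ?thesis
    unfolding bit_cons_def list_all_append list_all_map list.pred_inject by force
qed

lemma holds_copy:
  assumes "q < length P" "r \<le> K"
  shows "holds G (copy_con q b (if r = K then BelowL r else source (P ! q) r) r)"
  unfolding copy_con_def
proof (rule holds_AA)
  fix i j i' j'
  let ?p = "if r = K then BelowL r else source (P ! q) r"
  assume "j' \<le> Y" and "list_all (hold1 G (i, j)) [pos (At q), (b, ?p)]"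
  then have q: "q = fst (conf j)" and b: "interp G ?p [(i, j)] = b"
    by (simp_all add: interp_G del: if_split)
  have "interp G ?p [(i, j)] \<longleftrightarrow> i < reg r (Suc j)" if "j < Y"
  proof -
    obtain s where s: "conf j = (q, s)" using q by (metis prod.collapse)
    have "conf (Suc j) = step (P ! q) (q, s)" using conf_Suc[OF that] s by simp
    then show ?thesis
      using s by (cases "P ! q") (auto simp: interp_G reg_def)
  qed
  then show "list_ex (hold2 G (i, j) (i', j')) [neg Up, (b, Below r)]"
    using b \<open>j' \<le> Y\<close> by (auto simp: args_simps interp_binary interp_unary)
qed

lemma holds_jump:
  assumes "q < length P"
  shows "list_all (holds G) (jump_cons q (P ! q))"
proof -
  have *: "holds G (AA (pos (At q) # ls) [neg Up, pos (At p)])"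
    if follow: "\<And>i j s. j < Y \<Longrightarrow> conf j = (q, s) \<Longrightarrow> list_all (hold1 G (i, j)) ls \<Longrightarrow>
      fst (step (P ! q) (q, s)) = p" for ls p
  proof (rule holds_AA)
    fix i j i' j'
    assume "j' \<le> Y" and ls: "list_all (hold1 G (i, j)) (pos (At q) # ls)"
    then obtain s where s: "conf j = (q, s)" by (cases "conf j") (simp add: interp_G)
    have "list_all (hold1 G (i, j)) ls" using ls by simp
    then have "fst (conf (Suc j)) = p" if "j < Y"
      using conf_Suc[OF that] s follow[OF that s, of i] by simp
    then show "list_ex (hold2 G (i, j) (i', j')) [neg Up, pos (At p)]"
      using \<open>j' \<le> Y\<close> by (auto simp: args_simps interp_G)
  qed
  have "register (P ! q) < K" using assms registers by simp
  then have r: "snd (conf j) (register (P ! q)) = reg (register (P ! q)) j" for j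
    by (simp add: reg_def)
  show ?thesis
  proof (cases "P ! q")
    case (Inc r)
    then show ?thesis using *[of "[]"] by simp
  next
    case (Dec r)
    then show ?thesis using *[of "[]"] by simp
  next
    case (Jz k p p')
    have z: "s k = reg k j" if "conf j = (q, s)" for j s using r[of j] that Jz by simp
    show ?thesis
      unfolding Jz jump_cons.simps list.pred_inject
      by (intro conjI TrueI *) (simp_all add: Jz z interp_G)
  qed
qed

lemma holds_machine:
  assumes "c \<in> set (machine_cons P K)"
  shows "holds G c"
proof -
  have "list_all (holds G) (step_cons K q (P ! q))" if "q < length P" for q
    unfolding step_cons_def list_all_append list_all_concat list_all_map ball_set_map
    by (intro conjI ballI holds_jump holds_up holds_copy that) auto
  moreover have "list_all (holds G) grid_cons" using holds_grid by (simp add: list_all_iff)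
  ultimately have "list_all (holds G) (machine_cons P K)"
    unfolding machine_cons_def list_all_append list_all_concat ball_set_map
    by (intro conjI ballI holds_start holds_bits) (simp_all del: upt_Suc)
  then show ?thesis using assms by (simp add: list_all_iff)
qed

lemma counting_G: "counting G a"
  unfolding counting_def universe_G
proof (intro ballI impI)
  fix x
  assume "x \<in> {..X} \<times> {..Y}" and x: "interp G (Togo (Suc a)) [x]"
  obtain i j where ij: "x = (i, j)" by force
  have n: "i + Suc a = n" "j = 0" using x by (simp_all add: ij interp_G)
  moreover have "n + 4 \<le> X" using reg_bound[of 0 0] reg_0 by simp
  ultimately have "nxt X i = Suc i" by (simp add: nxt_def)
  then show "interp G (Below 0) [x] \<and>
      (\<forall>y\<in>{..X} \<times> {..Y}. interp G Rt [x, y] \<longrightarrow> interp G (Togo a) [y])"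
    using n by (auto simp: ij interp_G reg_0)
qed

lemma finite_model: "finite_model_3T G (Conj (machine_fm P K) (input_fm n))"
proof -
  have "transitive_in G (T k)" for k
    unfolding transitive_in_def transp_on_def interp_T using edge_trans[OF X] by blast
  from this[of 0] this[of 1] this[of 2]
  have "transitive_in G T1" "transitive_in G T2" "transitive_in G T3" by (simp_all add: T_def)
  moreover have "models G (Conj (machine_fm P K) (input_fm n))"
  proof -
    have "\<exists>x\<in>universe G. interp G (Togo n) [x] \<and> interp G Start [x]"
      unfolding universe_G by (intro bexI[of _ "(0, 0)"]) (simp_all add: interp_G)
    then show ?thesis
      unfolding models_def sat.simps sat_machine_fm sat_input_fm
      using holds_machine counting_G by blast
  qed
  ultimately show ?thesis by (simp add: finite_model_3T_def universe_G)
qed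

end

lemma halts_imp_fin_sat:
  assumes "\<And>I. I \<in> set P \<Longrightarrow> register I < K" "0 < K" "halts P (0, input n)"
  shows "fin_sat (Conj (machine_fm P K) (input_fm n))"
proof -
  define Y where "Y = (LEAST t. length P \<le> fst (run P (0, input n) t))"
  define R where "R r t = (if r = K then t else snd (run P (0, input n) t) r)" for r t
  \<comment> \<open>The sum bounds every register value, clock included, up to the halting time.
    Then \<open>4 * B + 7\<close> is congruent to 3 modulo 4 and exceeds each value by at least
    4.\<close>
  define B where "B = (\<Sum>t\<le>Y. \<Sum>r\<le>K. R r t)"
  have "length P \<le> fst (run P (0, input n) Y)"
    unfolding Y_def using assms(3) by (auto simp: halts_def intro: LeastI)
  moreover have "fst (run P (0, input n) t) < length P" if "t < Y" for t
    using not_less_Least[of t "\<lambda>t. length P \<le> fst (run P (0, input n) t)"] that unfolding Y_def by (simp add: not_le)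
  moreover have "R r t + 4 \<le> 4 * B + 7" if "t \<le> Y" "r \<le> K" for r t
  proof -
    have "R r t \<le> (\<Sum>r\<le>K. R r t)" using that by (intro member_le_sum) auto
    also have "\<dots> \<le> B" unfolding B_def using that by (intro member_le_sum) auto
    finally show ?thesis by simp
  qed
  moreover have "(4 * B + 7) mod 4 = 3" by presburger
  ultimately have "halting_machine P K n (4 * B + 7) Y"
    using assms(1,2) unfolding R_def by (intro halting_machine.intro)
  from halting_machine.finite_model[OF this] show ?thesis by (rule finite_model_3T_imp_fin_sat)
qed

lemma fin_sat_iff_halts:
  assumes "\<And>I. I \<in> set P \<Longrightarrow> register I < K" "0 < K"
  shows "fin_sat (Conj (machine_fm P K) (input_fm n)) \<longleftrightarrow> halts P (0, input n)"
  using finite_model_imp_halts halts_imp_fin_sat assms unfolding fin_sat_def by blast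

section \<open>The reduction is recursive\<close>

definition rec_add :: recf where
  "rec_add = PrimRec (Proj 0) (Comp Succ [Proj 1])"

definition rec_triangle :: recf where
  "rec_triangle = PrimRec Zero (Comp rec_add [Comp Succ [Proj 0], Proj 1])"

definition rec_pair :: recf where
  "rec_pair = Comp rec_add [Comp rec_triangle [rec_add], Proj 0]"

lemma rec_eval_Proj: "i < length xs \<Longrightarrow> z = xs ! i \<Longrightarrow> rec_eval (Proj i) xs z"
  using rec_eval.proj by simp

lemma rec_eval_Comp1: "rec_eval g xs y \<Longrightarrow> rec_eval f [y] z \<Longrightarrow> rec_eval (Comp f [g]) xs z"
  by (rule rec_eval.comp[of _ _ "[y]"]) simp_all

lemma rec_eval_Comp2:
  "rec_eval g xs x \<Longrightarrow> rec_eval h xs y \<Longrightarrow> rec_eval f [x, y] z \<Longrightarrow> rec_eval (Comp f [g, h]) xs z"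
  by (rule rec_eval.comp[of _ _ "[x, y]"]) simp_all

lemma rec_eval_add: "rec_eval rec_add [x, y] (x + y)"
proof (induction x)
  case 0
  show ?case unfolding rec_add_def by (auto intro!: rec_eval.prim_0 rec_eval_Proj)
next
  case (Suc x)
  have "rec_eval (Comp Succ [Proj 1]) [x, x + y, y] (Suc (x + y))"
    by (rule rec_eval_Comp1[OF rec_eval_Proj rec_eval.succ]) simp_all
  with Suc show ?case unfolding rec_add_def by (auto intro: rec_eval.prim_Suc)
qed

lemma rec_eval_triangle: "rec_eval rec_triangle [x] (triangle x)"
proof (induction x)
  case 0
  show ?case unfolding rec_triangle_def by (auto intro!: rec_eval.prim_0 rec_eval.zero)
next
  case (Suc x)
  have "rec_eval (Comp Succ [Proj 0]) [x, triangle x] (Suc x)"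
    by (rule rec_eval_Comp1[OF rec_eval_Proj rec_eval.succ]) simp_all
  then have "rec_eval (Comp rec_add [Comp Succ [Proj 0], Proj 1]) [x, triangle x] (Suc x + triangle x)"
    by (rule rec_eval_Comp2[OF _ rec_eval_Proj rec_eval_add]) simp_all
  with Suc show ?case unfolding rec_triangle_def by (auto intro: rec_eval.prim_Suc simp: add.commute)
qed

lemma rec_eval_pair: "rec_eval rec_pair [x, y] (prod_encode (x, y))"
  unfolding rec_pair_def prod_encode_def prod.case
  by (rule rec_eval_Comp2[OF rec_eval_Comp1[OF rec_eval_add rec_eval_triangle] rec_eval_Proj
        rec_eval_add]) simp_all

text \<open>Further arguments are allowed and ignored, so that such programs can be used unchanged
  inside a primitive recursion.\<close>

definition recursive :: "(nat \<Rightarrow> nat) \<Rightarrow> bool" where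
  "recursive F \<longleftrightarrow> (\<exists>f. \<forall>x xs. rec_eval f (x # xs) (F x))"

lemma recursive_id: "recursive (\<lambda>x. x)"
  unfolding recursive_def by (intro exI[of _ "Proj 0"]) (auto intro: rec_eval_Proj)

lemma recursive_Suc: "recursive F \<Longrightarrow> recursive (\<lambda>x. Suc (F x))"
  unfolding recursive_def by (meson rec_eval_Comp1 rec_eval.succ)

lemma recursive_const: "recursive (\<lambda>x. c)"
proof (induction c)
  case 0
  show ?case unfolding recursive_def using rec_eval.zero by blast
next
  case (Suc c)
  then show ?case by (rule recursive_Suc)
qed

lemma recursive_pair:
  assumes "recursive F" "recursive H"
  shows "recursive (\<lambda>x. prod_encode (F x, H x))"
  using assms rec_eval_Comp2 rec_eval_pair unfolding recursive_def by meson

lemma recursive_Togo: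
  assumes "recursive F"
  shows "recursive (\<lambda>x. fm_code (Atom (Togo (F x)) [v]))"
  unfolding Togo_def unary_def fm_code.simps psym_code.simps numeral_3_eq_3 add_Suc add_0
  by (intro recursive_pair recursive_Suc recursive_const assms)

lemma recursive_count_fm: "recursive (\<lambda>i. fm_code (count_fm i))"
proof -
  have "recursive (\<lambda>i. fm_code (Atom (Togo i) [2]))" "recursive (\<lambda>i. fm_code (Atom (Togo (Suc i)) [1]))"
    using recursive_Togo recursive_id recursive_Suc by blast+
  then show ?thesis
    unfolding count_fm_def fm_code.simps(3,5,8)
    by (intro recursive_pair recursive_const)
qed

lemma recursive_counts_fm: "recursive (\<lambda>n. fm_code (counts_fm n))"
proof -
  obtain f where f: "\<And>x xs. rec_eval f (x # xs) (fm_code (count_fm x))"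
    using recursive_count_fm unfolding recursive_def by blast
  have "recursive (\<lambda>x. 2)" "recursive (\<lambda>x. fm_code Top)" by (rule recursive_const)+
  then obtain two top where two: "\<And>x xs. rec_eval two (x # xs) 2"
    and top: "\<And>x xs. rec_eval top (x # xs) (fm_code Top)"
    unfolding recursive_def by blast
  define step where "step = Comp rec_pair [two, Comp rec_pair [f, Proj 1]]"
  have step: "rec_eval step (n # y # xs) (prod_encode (2, prod_encode (fm_code (count_fm n), y)))" for n y xs
    unfolding step_def
    by (rule rec_eval_Comp2[OF two rec_eval_Comp2[OF f rec_eval_Proj rec_eval_pair] rec_eval_pair]) simp_all
  \<comment> \<open>\<open>top\<close> is known to evaluate on nonempty lists, so the recursion
    carries a parameter \<open>x\<close>, for which the argument itself is supplied
    afterwards.\<close>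
  have "rec_eval (PrimRec top step) (n # x # xs) (fm_code (counts_fm n))" for n x xs
  proof (induction n)
    case 0
    show ?case using top by (auto intro: rec_eval.prim_0)
  next
    case (Suc n)
    then show ?case using rec_eval.prim_Suc[OF Suc step] by simp
  qed
  moreover have "rec_eval (Proj 0) (x # xs) x" for x xs by (rule rec_eval_Proj) simp_all
  ultimately have "rec_eval (Comp (PrimRec top step) [Proj 0, Proj 0]) (x # xs) (fm_code (counts_fm x))" for x xs
    by (intro rec_eval_Comp2[of "Proj 0" _ x "Proj 0" x])
  then show ?thesis unfolding recursive_def by blast
qed

lemma recursive_input_fm: "recursive (\<lambda>n. fm_code (input_fm n))"
proof -
  have "recursive (\<lambda>n. fm_code (Atom (Togo n) [1]))"
    using recursive_Togo recursive_id by blast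
  then show ?thesis
    unfolding input_fm_def fm_code.simps(3,7)
    by (intro recursive_pair recursive_const recursive_counts_fm)
qed

text \<open>A machine is run on the code of its own sentence; a decision procedure, applied to the sentence
  about this run, lets it halt if and only if the sentence has no finite model.\<close>

theorem theorem4p9: "\<not> decidable_problem FL2_3T fin_sat"
proof
  assume "decidable_problem FL2_3T fin_sat"
  then obtain f where f: "\<And>\<phi>. \<phi> \<in> FL2_3T \<Longrightarrow> rec_eval f [fm_code \<phi>] (if fin_sat \<phi> then 1 else 0)"
    unfolding decidable_problem_def by blast
  \<comment> \<open>The tag 2 belongs to \<open>Conj\<close>: if \<open>m\<close> codes a sentence,
    the value is the code of its conjunction with \<open>input_fm m\<close>.\<close>
  have "recursive (\<lambda>m. prod_encode (2, prod_encode (m, fm_code (input_fm m))))"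
    by (intro recursive_pair recursive_const recursive_id recursive_input_fm)
  then obtain h where h: "\<And>m. rec_eval h [m] (prod_encode (2, prod_encode (m, fm_code (input_fm m))))"
    unfolding recursive_def by blast
  obtain P where P: "\<And>m y. rec_eval (Comp f [h]) [m] y \<Longrightarrow> halts P (0, input m) \<longleftrightarrow> y = 0"
    using machine_halts_iff_0[of "Comp f [h]"] by blast
  \<comment> \<open>A number above the sum of all register indices is above each of them, so
    \<open>K\<close> is free for the clock.\<close>
  obtain K where K: "\<And>I. I \<in> set P \<Longrightarrow> register I < K" "0 < K"
  proof
    show "register I < Suc (sum_list (map register P))" if "I \<in> set P" for I
      using member_le_sum_list[of "register I" "map register P"] that by simp
  qed simp
  \<comment> \<open>The diagonal choice: the input is the code of the sentence built from the
    machine \<open>P\<close> itself.\<close>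
  define m where "m = fm_code (machine_fm P K)"
  define \<phi> where "\<phi> = Conj (machine_fm P K) (input_fm m)"
  have "rec_eval h [m] (fm_code \<phi>)" using h[of m] by (simp add: \<phi>_def m_def)
  moreover have "rec_eval f [fm_code \<phi>] (if fin_sat \<phi> then 1 else 0)"
    unfolding \<phi>_def by (rule f[OF input_machine_fm_in_FL2_3T])
  ultimately have "rec_eval (Comp f [h]) [m] (if fin_sat \<phi> then 1 else 0)" by (rule rec_eval_Comp1)
  \<comment> \<open>The answer 0, on which \<open>P\<close> halts, is the negative one.\<close>
  then have "halts P (0, input m) \<longleftrightarrow> \<not> fin_sat \<phi>" using P by fastforce
  then show False using fin_sat_iff_halts[OF K] by (simp add: \<phi>_def)
qed

end
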